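(* For every $Y\in\{\text{TJ},\text{TS},\text{TAR}\}$, the problem G-DA-Reconf-$Y$ (reconfiguration of global defensive alliances), parameterized by $k$, is fixed-parameter tractable.
   Context: For $A\subseteq V$: $N[A]=A\cup\bigcup_{v\in A}N(v)$, $d_A(v)=|N(v)\cap A|$. $A$ is a defensive alliance if $d_A(v)+1\ge d_{V\setminus A}(v)$ for all $v\in A$; a global defensive alliance is a defensive alliance that is a dominating set. Steps: token jumping (TJ): $|A|=|B|$, $|A\setminus B|=1$; token sliding (TS): TJ step with the vertex of $A\setminus B$ adjacent to the vertex of $B\setminus A$; token addition/removal (TAR): one set arises from the other by adding one vertex. G-DA-Reconf-$Y$: given $G$, global defensive alliances $A_s,A_t$ (and $k$ if $Y=\text{TAR}$), decide whether there is a sequence $A_s=A_1,\dots,A_\ell=A_t$ of global defensive alliances (each of size at most $k$ if $Y=\text{TAR}$), consecutive sets differing by a $Y$ step. The parameter $k$ is $|A_s|=|A_t|$ for TJ/TS and the size threshold for TAR. *)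

theory Defs
  imports Main
begin

section \<open>Fixed-parameter tractability\<close>

text \<open>
  The machine model is a unit-cost random access machine on natural numbers with addition,
  truncated subtraction and halving, but without multiplication, so that running times agree with
  those of Turing machines up to a polynomial. Control flow is structured instead of using jumps.
  A state consists of the registers, which instructions name directly, and of the memory, which is
  accessed only by indirect addressing through registers.
\<close>

type_synonym state = "(nat \<Rightarrow> nat) \<times> (nat \<Rightarrow> nat)"

datatype com =
    Const nat nat
  | Move nat nat
  | Add nat nat nat
  | Sub nat nat nat
  | Half nat nat
  | Load nat nat
  | Store nat nat
  | Seq com com
  | IfNZ nat com com
  | WhileNZ nat com

text \<open>In \<open>exec c s t s'\<close> the number \<open>t\<close> is the running time. Every basic instruction and every test
  of a register against zero costs one step.\<close>

inductive exec :: "com \<Rightarrow> state \<Rightarrow> nat \<Rightarrow> state \<Rightarrow> bool" where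
  Const: "exec (Const i n) (r, m) 1 (r(i := n), m)"
| Move: "exec (Move i j) (r, m) 1 (r(i := r j), m)"
| Add: "exec (Add i j l) (r, m) 1 (r(i := r j + r l), m)"
| Sub: "exec (Sub i j l) (r, m) 1 (r(i := r j - r l), m)"
| Half: "exec (Half i j) (r, m) 1 (r(i := r j div 2), m)"
| Load: "exec (Load i j) (r, m) 1 (r(i := m (r j)), m)"
| Store: "exec (Store i j) (r, m) 1 (r, m(r i := r j))"
| Seq: "exec c1 s1 t1 s2 \<Longrightarrow> exec c2 s2 t2 s3 \<Longrightarrow> exec (Seq c1 c2) s1 (t1 + t2) s3"
| IfTrue: "fst s i \<noteq> 0 \<Longrightarrow> exec c1 s t s' \<Longrightarrow> exec (IfNZ i c1 c2) s (t + 1) s'"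
| IfFalse: "fst s i = 0 \<Longrightarrow> exec c2 s t s' \<Longrightarrow> exec (IfNZ i c1 c2) s (t + 1) s'"
| WhileFalse: "fst s i = 0 \<Longrightarrow> exec (WhileNZ i c) s 1 s"
| WhileTrue: "fst s1 i \<noteq> 0 \<Longrightarrow> exec c s1 t1 s2 \<Longrightarrow> exec (WhileNZ i c) s2 t2 s3 \<Longrightarrow>
    exec (WhileNZ i c) s1 (t1 + t2 + 1) s3"

inductive_cases exec_elims:
  "exec (Const i n) s t s'" "exec (Move i j) s t s'" "exec (Add i j l) s t s'"
  "exec (Sub i j l) s t s'" "exec (Half i j) s t s'" "exec (Load i j) s t s'"
  "exec (Store i j) s t s'"
inductive_cases exec_Seq_elim: "exec (Seq c1 c2) s t s'"
inductive_cases exec_IfNZ_elim: "exec (IfNZ i c1 c2) s t s'"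
inductive_cases exec_WhileNZ_elim: "exec (WhileNZ i c) s t s'"

lemma exec_deterministic:
  assumes "exec c s t s'" and "exec c s u s''"
  shows "t = u \<and> s' = s''"
  using assms
proof (induction arbitrary: u s'' rule: exec.induct)
  case (Seq c1 s1 t1 s2 c2 t2 s3)
  obtain u1 u2 s2' where "u = u1 + u2" "exec c1 s1 u1 s2'" "exec c2 s2' u2 s''"
    using Seq.prems by (rule exec_Seq_elim)
  then show ?case using Seq.IH by metis
next
  case (IfTrue s i c1 t s' c2)
  obtain u1 where "u = u1 + 1" "exec c1 s u1 s''"
    using IfTrue.prems IfTrue.hyps(1) by (auto elim: exec_IfNZ_elim)
  then show ?case using IfTrue.IH by metis
next
  case (IfFalse s i c2 t s' c1)
  obtain u1 where "u = u1 + 1" "exec c2 s u1 s''"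
    using IfFalse.prems IfFalse.hyps(1) by (auto elim: exec_IfNZ_elim)
  then show ?case using IfFalse.IH by metis
next
  case (WhileFalse s i c)
  from WhileFalse.prems WhileFalse.hyps show ?case
    by (rule_tac exec_WhileNZ_elim) auto
next
  case (WhileTrue s1 i c t1 s2 t2 s3)
  obtain u1 s2' u2 where
    "u = u1 + u2 + 1" "exec c s1 u1 s2'" "exec (WhileNZ i c) s2' u2 s''"
    using WhileTrue.prems WhileTrue.hyps(1) by (rule_tac exec_WhileNZ_elim) auto
  then show ?case using WhileTrue.IH by metis
qed (erule exec_elims; simp)+

definition computable :: "(nat \<Rightarrow> nat) \<Rightarrow> bool" where
  "computable f \<longleftrightarrow>
    (\<exists>c. \<forall>k. \<exists>t r m. exec c ((\<lambda>_. 0)(0 := k), \<lambda>_. 0) t (r, m) \<and> r 0 = f k)"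

text \<open>The input word is stored one bit per memory cell; its length, which cannot be recovered from
  the memory contents, and the parameter are supplied in registers.\<close>

definition input_state :: "bool list \<Rightarrow> nat \<Rightarrow> state" where
  "input_state x k =
    ((\<lambda>_. 0)(0 := k, 1 := length x), \<lambda>i. if i < length x then of_bool (x ! i) else 0)"

type_synonym parameterized_problem = "(bool list \<times> nat) set"

text \<open>Words that do not encode an instance have to be rejected within the time bound as well.
  Using \<open>length x + 1\<close> instead of the size of the pair \<open>(x, k)\<close> only changes \<open>f\<close>, and the
  summand 1 only serves to cover the empty word.\<close>

definition fixed_parameter_tractable :: "parameterized_problem \<Rightarrow> bool" where
  "fixed_parameter_tractable L \<longleftrightarrow>
    (\<exists>c f d. computable f \<and>
      (\<forall>x k. \<exists>t r m. exec c (input_state x k) t (r, m) \<and>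
        t \<le> f k * (length x + 1) ^ d \<and>
        r 0 = (if (x, k) \<in> L then 1 else 0)))"


section \<open>Global defensive alliances\<close>

definition simple_graph :: "'a set \<Rightarrow> 'a set set \<Rightarrow> bool" where
  "simple_graph V E \<longleftrightarrow> finite V \<and> (\<forall>e\<in>E. e \<subseteq> V \<and> card e = 2)"

definition neighbours :: "'a set set \<Rightarrow> 'a \<Rightarrow> 'a set" where
  "neighbours E v = {u. {v, u} \<in> E}"

definition closed_neighbourhood :: "'a set set \<Rightarrow> 'a set \<Rightarrow> 'a set" where
  "closed_neighbourhood E A = A \<union> (\<Union>v\<in>A. neighbours E v)"

definition degree_in :: "'a set set \<Rightarrow> 'a set \<Rightarrow> 'a \<Rightarrow> nat" where
  "degree_in E A v = card (neighbours E v \<inter> A)"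

definition defensive_alliance :: "'a set \<Rightarrow> 'a set set \<Rightarrow> 'a set \<Rightarrow> bool" where
  "defensive_alliance V E A \<longleftrightarrow>
    A \<subseteq> V \<and> (\<forall>v\<in>A. degree_in E A v + 1 \<ge> degree_in E (V - A) v)"

definition dominating_set :: "'a set \<Rightarrow> 'a set set \<Rightarrow> 'a set \<Rightarrow> bool" where
  "dominating_set V E A \<longleftrightarrow> A \<subseteq> V \<and> closed_neighbourhood E A = V"

definition global_defensive_alliance :: "'a set \<Rightarrow> 'a set set \<Rightarrow> 'a set \<Rightarrow> bool" where
  "global_defensive_alliance V E A \<longleftrightarrow> defensive_alliance V E A \<and> dominating_set V E A"


section \<open>Reconfiguration\<close>

datatype rule = TJ | TS | TAR

fun step :: "rule \<Rightarrow> 'a set set \<Rightarrow> 'a set \<Rightarrow> 'a set \<Rightarrow> bool" where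
  "step TJ E A B \<longleftrightarrow> card A = card B \<and> card (A - B) = 1"
| "step TS E A B \<longleftrightarrow> card A = card B \<and> card (A - B) = 1 \<and>
    (\<exists>u\<in>A - B. \<exists>v\<in>B - A. {u, v} \<in> E)"
| "step TAR E A B \<longleftrightarrow> (\<exists>v. v \<notin> A \<and> B = insert v A) \<or> (\<exists>v. v \<notin> B \<and> A = insert v B)"

definition reconfigurable ::
    "rule \<Rightarrow> nat \<Rightarrow> 'a set \<Rightarrow> 'a set set \<Rightarrow> 'a set \<Rightarrow> 'a set \<Rightarrow> bool" where
  "reconfigurable Y k V E As At \<longleftrightarrow>
    (\<exists>Ss. Ss \<noteq> [] \<and> hd Ss = As \<and> last Ss = At \<and>
      (\<forall>A\<in>set Ss. global_defensive_alliance V E A \<and> (Y = TAR \<longrightarrow> card A \<le> k)) \<and>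
      successively (step Y E) Ss)"

text \<open>Instances are encoded with vertex set \<open>{..<n}\<close>: the number \<open>n\<close> in unary, the adjacency matrix
  row by row, and the characteristic vectors of the two sets.\<close>

definition encode :: "nat \<Rightarrow> nat set set \<Rightarrow> nat set \<Rightarrow> nat set \<Rightarrow> bool list" where
  "encode n E As At =
    replicate n True @ [False] @
    map (\<lambda>i. {i div n, i mod n} \<in> E) [0..<n * n] @
    map (\<lambda>v. v \<in> As) [0..<n] @
    map (\<lambda>v. v \<in> At) [0..<n]"

lemma encode_injective:
  assumes G: "simple_graph {..<n} E" "As \<subseteq> {..<n}" "At \<subseteq> {..<n}"
    and G': "simple_graph {..<n'} E'" "As' \<subseteq> {..<n'}" "At' \<subseteq> {..<n'}"
    and eq: "encode n E As At = encode n' E' As' At'"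
  shows "n = n' \<and> E = E' \<and> As = As' \<and> At = At'"
proof -
  have tw: "takeWhile id (encode i F S T) = replicate i True" for i F S T
    by (induction i) (auto simp: encode_def takeWhile_append)
  have n: "n = n'"
    using tw[of n E As At] tw[of n' E' As' At'] eq by (metis length_replicate)
  have mat: "\<forall>i<n * n. ({i div n, i mod n} \<in> E) = ({i div n, i mod n} \<in> E')"
    and sets: "\<forall>v<n. (v \<in> As) = (v \<in> As')" "\<forall>v<n. (v \<in> At) = (v \<in> At')"
    using eq by (auto simp: encode_def n)
  have adj: "({u, v} \<in> E) = ({u, v} \<in> E')" if "u < n" "v < n" for u v
  proof -
    have "u * n + v < Suc u * n" using that by simp
    also have "\<dots> \<le> n * n" using that by (intro mult_right_mono) auto
    finally show ?thesis using mat that by (auto dest!: spec[of _ "u * n + v"])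
  qed
  have "e \<in> E \<longleftrightarrow> e \<in> E'" for e
  proof (cases "\<exists>u v. u < n \<and> v < n \<and> e = {u, v}")
    case True
    then show ?thesis using adj by auto
  next
    case False
    have "e \<notin> F" if "simple_graph {..<n} F" for F
    proof
      assume "e \<in> F"
      then have "e \<subseteq> {..<n}" "card e = 2" using that by (auto simp: simple_graph_def)
      then show False using False by (auto simp: card_2_iff)
    qed
    then show ?thesis using G(1) G'(1) n by auto
  qed
  then show ?thesis using n sets G G' by auto
qed

text \<open>For token jumping and token sliding the parameter has to be the common size of the two given
  alliances; for token addition and removal it is the size threshold.\<close>

definition GDA_Reconf :: "rule \<Rightarrow> parameterized_problem" where
  "GDA_Reconf Y =
    {(encode n E As At, k) | n E As At k.
      simple_graph {..<n} E \<and>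
      global_defensive_alliance {..<n} E As \<and>
      global_defensive_alliance {..<n} E At \<and>
      (Y \<noteq> TAR \<longrightarrow> card As = k \<and> card At = k) \<and>
      reconfigurable Y k {..<n} E As At}"

end

theory Submission
  imports Defs "HOL-Library.Nat_Bijection"
begin

text \<open>
  In a graph with a global defensive alliance of size at most \<open>k\<close>, every vertex of the alliance has
  at most \<open>k + 1\<close> neighbours outside of it, so there are fewer than \<open>(k + 1)\<^sup>2\<close> vertices, and the length
  of a yes-instance is bounded in \<open>k\<close>. Longer words are rejected at once. On the remaining ones any
  algorithm will do whose running time is bounded by a computable function of the instance, since
  there are only finitely many of them for each \<open>k\<close>.

  Such an algorithm is the evaluation of an arithmetic expression with bounded sums, in which vertex
  sets are numbers and families of vertex sets are numbers again; there is a reconfiguration sequence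
  iff \<open>A\<^sub>t\<close> belongs to every family that contains \<open>A\<^sub>s\<close> and is closed under admissible steps. The
  running time of an evaluation is bounded by an expression of the same kind. Summing this over all
  short words yields an expression in \<open>k\<close>, and its evaluation is the program that shows that the time
  bound is computable.
\<close>

section \<open>Bounded arithmetic expressions and their compilation\<close>

text \<open>A product is a \<open>Sum\<close> whose body ignores the bound variable. All loops are
  bounded, so every evaluation terminates.\<close>

datatype expr =
    Var nat
  | Num nat
  | Plus expr expr
  | Minus expr expr
  | Pow2 expr
  | Bit expr expr
  | Sum nat expr expr

primrec eval :: "expr \<Rightarrow> (nat \<Rightarrow> nat) \<Rightarrow> nat" where
  "eval (Var i) r = r i"
| "eval (Num n) r = n"
| "eval (Plus a b) r = eval a r + eval b r"
| "eval (Minus a b) r = eval a r - eval b r"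
| "eval (Pow2 a) r = 2 ^ eval a r"
| "eval (Bit a b) r = of_bool (eval a r \<in> set_decode (eval b r))"
| "eval (Sum v a b) r = (\<Sum>i<eval a r. eval b (r(v := i)))"

primrec vars_below :: "nat \<Rightarrow> expr \<Rightarrow> bool" where
  "vars_below d (Var i) \<longleftrightarrow> i < d"
| "vars_below d (Num n) \<longleftrightarrow> True"
| "vars_below d (Plus a b) \<longleftrightarrow> vars_below d a \<and> vars_below d b"
| "vars_below d (Minus a b) \<longleftrightarrow> vars_below d a \<and> vars_below d b"
| "vars_below d (Pow2 a) \<longleftrightarrow> vars_below d a"
| "vars_below d (Bit a b) \<longleftrightarrow> vars_below d a \<and> vars_below d b"
| "vars_below d (Sum v a b) \<longleftrightarrow> v < d \<and> vars_below d a \<and> vars_below d b"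

lemma vars_below_mono: "vars_below d e \<Longrightarrow> d \<le> d' \<Longrightarrow> vars_below d' e"
  by (induction e) auto

text \<open>Compiled code overwrites registers from \<open>d\<close> on as scratch space;
  expressions with variables below \<open>d\<close> do not notice.\<close>

lemma eval_cong: "vars_below d e \<Longrightarrow> (\<And>i. i < d \<Longrightarrow> r i = r' i) \<Longrightarrow> eval e r = eval e r'"
proof (induction e arbitrary: r r')
  case (Sum v a b)
  have "eval a r = eval a r'"
    using Sum.prems by (intro Sum.IH(1)) auto
  moreover have "eval b (r(v := i)) = eval b (r'(v := i))" for i
    using Sum.prems by (intro Sum.IH(2)) auto
  ultimately show ?case by simp
next
  case (Plus a b)
  then have "eval a r = eval a r'" "eval b r = eval b r'" by (unfold vars_below.simps, blast)+
  then show ?case by simp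
next
  case (Minus a b)
  then have "eval a r = eval a r'" "eval b r = eval b r'" by (unfold vars_below.simps, blast)+
  then show ?case by simp
next
  case (Bit a b)
  then have "eval a r = eval a r'" "eval b r = eval b r'" by (unfold vars_below.simps, blast)+
  then show ?case by simp
next
  case (Pow2 a)
  then have "eval a r = eval a r'" by (unfold vars_below.simps, blast)
  then show ?case by simp
qed simp_all

text \<open>The result is left in register \<open>d\<close>; all registers below \<open>d\<close> keep their values.\<close>

primrec compile :: "expr \<Rightarrow> nat \<Rightarrow> com" where
  "compile (Var i) d = Move d i"
| "compile (Num n) d = Const d n"
| "compile (Plus a b) d = Seq (compile a d) (Seq (compile b (d + 1)) (Add d d (d + 1)))"
| "compile (Minus a b) d = Seq (compile a d) (Seq (compile b (d + 1)) (Sub d d (d + 1)))"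
| "compile (Pow2 a) d =
    Seq (compile a d) (Seq (Const (d + 1) 1) (Seq (Const (d + 2) 1)
      (Seq (WhileNZ d (Seq (Sub d d (d + 2)) (Add (d + 1) (d + 1) (d + 1))))
        (Move d (d + 1)))))"
| "compile (Bit a b) d =
    Seq (compile a d) (Seq (compile b (d + 1)) (Seq (Const (d + 2) 1)
      (Seq (WhileNZ d (Seq (Sub d d (d + 2)) (Half (d + 1) (d + 1))))
        (Seq (Half d (d + 1)) (Seq (Add d d d) (Sub d (d + 1) d))))))"
| "compile (Sum v a b) d =
    Seq (compile a d) (Seq (Move (d + 1) v) (Seq (Move v d) (Seq (Const (d + 2) 0)
      (Seq (WhileNZ v (Seq (Const (d + 3) 1) (Seq (Sub v v (d + 3))
          (Seq (compile b (d + 3)) (Add (d + 2) (d + 2) (d + 3))))))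
        (Seq (Move v (d + 1)) (Move d (d + 2)))))))"

text \<open>The running time of a compiled expression is again bounded by an expression, so that it
  can be computed by a compiled program as well.\<close>

primrec cost :: "expr \<Rightarrow> expr" where
  "cost (Var i) = Num 1"
| "cost (Num n) = Num 1"
| "cost (Plus a b) = Plus (cost a) (Plus (cost b) (Num 1))"
| "cost (Minus a b) = Plus (cost a) (Plus (cost b) (Num 1))"
| "cost (Pow2 a) = Plus (cost a) (Plus (Plus a (Plus a a)) (Num 4))"
| "cost (Bit a b) = Plus (cost a) (Plus (cost b) (Plus (Plus a (Plus a a)) (Num 5)))"
| "cost (Sum v a b) = Plus (cost a) (Plus (Sum v a (Plus (cost b) (Num 4))) (Num 6))"

lemma vars_below_cost: "vars_below d e \<Longrightarrow> vars_below d (cost e)"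
  by (induction e) auto

section \<open>Time-bounded total correctness of programs\<close>

text \<open>The final memory is again \<open>m\<close>: the programs below read the memory but never
  contain \<open>Store\<close>.\<close>

definition runs ::
    "com \<Rightarrow> (nat \<Rightarrow> nat) \<Rightarrow> (nat \<Rightarrow> nat) \<Rightarrow> nat \<Rightarrow> ((nat \<Rightarrow> nat) \<Rightarrow> bool) \<Rightarrow> bool" where
  "runs c r m b Q \<longleftrightarrow> (\<exists>t r'. exec c (r, m) t (r', m) \<and> t \<le> b \<and> Q r')"

lemma runs_mono: "runs c r m b P \<Longrightarrow> b \<le> b' \<Longrightarrow> (\<And>r'. P r' \<Longrightarrow> Q r') \<Longrightarrow> runs c r m b' Q"
  unfolding runs_def by (meson le_trans)

lemma runs_basic:
  "Q (r(i := n)) \<Longrightarrow> runs (Const i n) r m 1 Q"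
  "Q (r(i := r j)) \<Longrightarrow> runs (Move i j) r m 1 Q"
  "Q (r(i := r j + r l)) \<Longrightarrow> runs (Add i j l) r m 1 Q"
  "Q (r(i := r j - r l)) \<Longrightarrow> runs (Sub i j l) r m 1 Q"
  "Q (r(i := r j div 2)) \<Longrightarrow> runs (Half i j) r m 1 Q"
  "Q (r(i := m (r j))) \<Longrightarrow> runs (Load i j) r m 1 Q"
  unfolding runs_def by (blast intro: exec.intros)+

lemma runs_Seq:
  assumes "runs c1 r m b1 P" and "\<And>r'. P r' \<Longrightarrow> runs c2 r' m b2 Q"
  shows "runs (Seq c1 c2) r m (b1 + b2) Q"
proof -
  obtain t1 r1 where "exec c1 (r, m) t1 (r1, m)" "t1 \<le> b1" "P r1"
    using assms(1) by (auto simp: runs_def)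
  moreover obtain t2 r2 where "exec c2 (r1, m) t2 (r2, m)" "t2 \<le> b2" "Q r2"
    using assms(2)[OF \<open>P r1\<close>] by (auto simp: runs_def)
  ultimately show ?thesis
    unfolding runs_def by (meson exec.Seq add_mono)
qed

lemma runs_Seq_basic:
  "runs c (r(i := n)) m b Q \<Longrightarrow> runs (Seq (Const i n) c) r m (b + 1) Q"
  "runs c (r(i := r j)) m b Q \<Longrightarrow> runs (Seq (Move i j) c) r m (b + 1) Q"
  "runs c (r(i := r j + r l)) m b Q \<Longrightarrow> runs (Seq (Add i j l) c) r m (b + 1) Q"
  "runs c (r(i := r j - r l)) m b Q \<Longrightarrow> runs (Seq (Sub i j l) c) r m (b + 1) Q"
  "runs c (r(i := r j div 2)) m b Q \<Longrightarrow> runs (Seq (Half i j) c) r m (b + 1) Q"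
  "runs c (r(i := m (r j))) m b Q \<Longrightarrow> runs (Seq (Load i j) c) r m (b + 1) Q"
  by (subst add.commute, rule runs_Seq[where P = "(=) _"], rule runs_basic, rule refl, simp)+

lemma runs_If:
  assumes "r i \<noteq> 0 \<Longrightarrow> runs c1 r m b Q" and "r i = 0 \<Longrightarrow> runs c2 r m b Q"
  shows "runs (IfNZ i c1 c2) r m (b + 1) Q"
proof (cases "r i = 0")
  case True
  then obtain t r' where "exec c2 (r, m) t (r', m)" "t \<le> b" "Q r'"
    using assms by (auto simp: runs_def)
  then show ?thesis
    using True exec.IfFalse[of "(r, m)" i c2 t "(r', m)" c1] unfolding runs_def
    by (metis add_le_mono1 fst_conv)
next
  case False
  then obtain t r' where "exec c1 (r, m) t (r', m)" "t \<le> b" "Q r'"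
    using assms by (auto simp: runs_def)
  then show ?thesis
    using False exec.IfTrue[of "(r, m)" i c1 t "(r', m)" c2] unfolding runs_def
    by (metis add_le_mono1 fst_conv)
qed

text \<open>Every loop counts down, and the invariant is indexed by the number of iterations left.
  Each iteration pays 1 for its test; the last 1 is the failing test.\<close>

lemma runs_While:
  assumes counter: "\<And>j r. I j r \<Longrightarrow> r i = j"
    and body: "\<And>j r. j < n \<Longrightarrow> I (Suc j) r \<Longrightarrow> runs c r m (b j) (I j)"
    and "I n r"
  shows "runs (WhileNZ i c) r m ((\<Sum>j<n. b j + 1) + 1) (I 0)"
  using body \<open>I n r\<close>
proof (induction n arbitrary: r)
  case 0
  then show ?case
    using counter[of 0 r] exec.WhileFalse[of "(r, m)" i c] by (auto simp: runs_def)
next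
  case (Suc n)
  obtain t1 r1 where 1: "exec c (r, m) t1 (r1, m)" "t1 \<le> b n" "I n r1"
    using Suc.prems by (metis lessI runs_def)
  have "runs (WhileNZ i c) r1 m ((\<Sum>j<n. b j + 1) + 1) (I 0)"
    using Suc.IH[OF _ 1(3)] Suc.prems(1) by simp
  then obtain t2 r2 where 2: "exec (WhileNZ i c) (r1, m) t2 (r2, m)"
      "t2 \<le> (\<Sum>j<n. b j + 1) + 1" "I 0 r2"
    by (auto simp: runs_def)
  have "r i \<noteq> 0"
    using counter[OF Suc.prems(2)] by simp
  then have "exec (WhileNZ i c) (r, m) (t1 + t2 + 1) (r2, m)"
    using exec.WhileTrue[OF _ 1(1) 2(1)] by simp
  moreover have "t1 + t2 + 1 \<le> (\<Sum>j<Suc n. b j + 1) + 1"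
    using 1(2) 2(2) by simp
  ultimately show ?case
    using 2(3) unfolding runs_def by blast
qed

text \<open>The program for \<open>Bit\<close> isolates the lowest bit in this way, having only
  halving, addition and subtraction at its disposal.\<close>

lemma bit_by_halving: "w - (w div 2 + w div 2) = of_bool (odd (w::nat))"
  by (cases "even w") (auto elim!: evenE oddE)

text \<open>Keeping all registers below \<open>d\<close> does two jobs: the variables of
  \<open>e\<close> survive, and an intermediate result in register \<open>d\<close> survives the
  evaluation of a second operand at \<open>d + 1\<close>.\<close>

lemma runs_compile:
  assumes "vars_below d e"
  shows "runs (compile e d) r m (eval (cost e) r)
    (\<lambda>r'. r' d = eval e r \<and> (\<forall>i<d. r' i = r i))"
  using assms
proof (induction e arbitrary: d r)
  case (Var i)
  then show ?case by (auto intro!: runs_basic[unfolded One_nat_def])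
next
  case (Num n)
  then show ?case by (auto intro!: runs_basic[unfolded One_nat_def])
next
  case (Plus a b)
  have b: "vars_below (d + 1) b" using Plus.prems by (auto intro: vars_below_mono)
  have "runs (compile (Plus a b) d) r m (eval (cost a) r + (eval (cost b) r + 1))
    (\<lambda>r'. r' d = eval (Plus a b) r \<and> (\<forall>i<d. r' i = r i))"
    unfolding compile.simps
  proof (rule runs_Seq[OF Plus.IH(1)], goal_cases)
    case (2 r1)
    \<comment> \<open>\<open>runs_Seq\<close> wants a bound for the second command that is
      independent of the intermediate state, so the cost is moved back to \<open>r\<close>.\<close>
    have "eval b r1 = eval b r" "eval (cost b) r1 = eval (cost b) r"
      using 2 Plus.prems by (auto intro!: eval_cong[of d] vars_below_cost)
    with 2 Plus.IH(2)[OF b, of r1] show ?case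
      by (intro runs_Seq[where P = "\<lambda>r'. r' (d + 1) = eval b r1 \<and> (\<forall>i<d+1. r' i = r1 i)"]
        runs_basic) (auto simp: less_Suc_eq)
  qed (use Plus.prems in auto)
  then show ?case by simp
next
  case (Minus a b)
  have b: "vars_below (d + 1) b" using Minus.prems by (auto intro: vars_below_mono)
  have "runs (compile (Minus a b) d) r m (eval (cost a) r + (eval (cost b) r + 1))
    (\<lambda>r'. r' d = eval (Minus a b) r \<and> (\<forall>i<d. r' i = r i))"
    unfolding compile.simps
  proof (rule runs_Seq[OF Minus.IH(1)], goal_cases)
    case (2 r1)
    have "eval b r1 = eval b r" "eval (cost b) r1 = eval (cost b) r"
      using 2 Minus.prems by (auto intro!: eval_cong[of d] vars_below_cost)
    with 2 Minus.IH(2)[OF b, of r1] show ?case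
      by (intro runs_Seq[where P = "\<lambda>r'. r' (d + 1) = eval b r1 \<and> (\<forall>i<d+1. r' i = r1 i)"]
        runs_basic) (auto simp: less_Suc_eq)
  qed (use Minus.prems in auto)
  then show ?case by simp
next
  case (Pow2 a)
  let ?n = "eval a r"
  \<comment> \<open>With \<open>j\<close> doublings left, the product form states the value of the
    accumulator without a difference of exponents.\<close>
  let ?I = "\<lambda>j r'. r' d = j \<and> r' (d + 1) * 2 ^ j = 2 ^ ?n \<and> r' (d + 2) = 1 \<and>
    (\<forall>i<d. r' i = r i)"
  have "runs (compile (Pow2 a) d) r m (eval (cost a) r + ((((\<Sum>j<?n. (1 + 1) + 1) + 1) + 1) + 1 + 1))
    (\<lambda>r'. r' d = eval (Pow2 a) r \<and> (\<forall>i<d. r' i = r i))"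
    unfolding compile.simps
  proof (rule runs_Seq[OF Pow2.IH], goal_cases)
    case (2 r1)
    show ?case
    proof (rule runs_Seq_basic, rule runs_Seq_basic, rule runs_Seq)
      show "runs (WhileNZ d (Seq (Sub d d (d + 2)) (Add (d + 1) (d + 1) (d + 1))))
          (r1(d + 1 := 1, d + 2 := 1)) m ((\<Sum>j<?n. (1 + 1) + 1) + 1) (?I 0)"
      proof (rule runs_While[where I = ?I])
        show "?I ?n (r1(d + 1 := 1, d + 2 := 1))" using 2 by simp
        fix j r2 assume *: "?I (Suc j) r2"
        show "runs (Seq (Sub d d (d + 2)) (Add (d + 1) (d + 1) (d + 1))) r2 m (1 + 1) (?I j)"
          by (rule runs_Seq_basic, rule runs_basic)
            (use * in \<open>auto simp: algebra_simps\<close>)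
      qed simp
    qed (auto intro!: runs_basic[unfolded One_nat_def])
  qed (use Pow2.prems in auto)
  then show ?case by (rule runs_mono) simp_all
next
  case (Bit a b)
  let ?n = "eval a r"
  \<comment> \<open>With \<open>j\<close> halvings left, shifting by \<open>j\<close> more places
    gives the desired shift of \<open>eval b r\<close> by \<open>?n\<close>.\<close>
  let ?I = "\<lambda>j r'. r' d = j \<and> r' (d + 1) div 2 ^ j = eval b r div 2 ^ ?n \<and> r' (d + 2) = 1 \<and>
    (\<forall>i<d. r' i = r i)"
  have b: "vars_below (d + 1) b" using Bit.prems by (auto intro: vars_below_mono)
  have "runs (compile (Bit a b) d) r m
    (eval (cost a) r + (eval (cost b) r + ((((\<Sum>j<?n. (1 + 1) + 1) + 1) + (1 + 1 + 1)) + 1)))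
    (\<lambda>r'. r' d = eval (Bit a b) r \<and> (\<forall>i<d. r' i = r i))"
    unfolding compile.simps
  proof (rule runs_Seq[OF Bit.IH(1)], goal_cases)
    case (2 r0)
    have eq: "eval b r0 = eval b r" "eval (cost b) r0 = eval (cost b) r"
      using 2 Bit.prems by (auto intro!: eval_cong[of d] vars_below_cost)
    show ?case
    proof (subst eq(2)[symmetric], rule runs_Seq[OF Bit.IH(2)[OF b]],
        rule runs_Seq_basic, rule runs_Seq[where P = "?I 0"], goal_cases)
      case (1 r1)
      show "runs (WhileNZ d (Seq (Sub d d (d + 2)) (Half (d + 1) (d + 1))))
          (r1(d + 2 := 1)) m ((\<Sum>j<?n. (1 + 1) + 1) + 1) (?I 0)"
      proof (rule runs_While[where I = ?I])
        show "?I ?n (r1(d + 2 := 1))" using 1 2 eq by simp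
        fix j r2 assume *: "?I (Suc j) r2"
        show "runs (Seq (Sub d d (d + 2)) (Half (d + 1) (d + 1))) r2 m (1 + 1) (?I j)"
          by (rule runs_Seq_basic, rule runs_basic)
            (use * in \<open>auto simp: div_mult2_eq[symmetric]\<close>)
      qed simp
    next
      case (2 r1 r2)
      then show ?case
        by (intro runs_Seq_basic runs_basic) (auto simp: bit_by_halving set_decode_def)
    qed
  qed (use Bit.prems in auto)
  then show ?case by (rule runs_mono) simp_all
next
  case (Sum v a b)
  let ?n = "eval a r"
  let ?b = "\<lambda>j. eval b (r(v := j))"
  let ?c = "\<lambda>j. eval (cost b) (r(v := j))"
  \<comment> \<open>The loop counter is \<open>v\<close> itself, running downwards;
    \<open>d + 1\<close> saves its old value, and \<open>d + 2\<close> collects the summands from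
    index \<open>j\<close> on.\<close>
  let ?I = "\<lambda>j r'. r' v = j \<and> r' (d + 1) = r v \<and> r' (d + 2) = (\<Sum>i=j..<?n. ?b i) \<and>
    (\<forall>i<d. i \<noteq> v \<longrightarrow> r' i = r i)"
  let ?body = "Seq (Const (d + 3) 1) (Seq (Sub v v (d + 3))
    (Seq (compile b (d + 3)) (Add (d + 2) (d + 2) (d + 3))))"
  have b: "vars_below (d + 3) b" and v: "v < d" using Sum.prems by (auto intro: vars_below_mono)
  have body: "runs ?body r2 m (?c j + 1 + 1 + 1) (?I j)" if "j < ?n" "?I (Suc j) r2" for j r2
  proof (rule runs_Seq_basic, rule runs_Seq_basic)
    let ?r = "r2(d + 3 := 1, v := j)"
    have eq: "eval b ?r = ?b j" "eval (cost b) ?r = ?c j"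
      using that Sum.prems by (auto intro!: eval_cong[of d] vars_below_cost)
    have r: "(r2(d + 3 := 1))(v := (r2(d + 3 := 1)) v - (r2(d + 3 := 1)) (d + 3)) = ?r"
      using that v by auto
    show "runs (Seq (compile b (d + 3)) (Add (d + 2) (d + 2) (d + 3)))
      ((r2(d + 3 := 1))(v := (r2(d + 3 := 1)) v - (r2(d + 3 := 1)) (d + 3))) m (?c j + 1) (?I j)"
      unfolding r eq(2)[symmetric]
    proof (rule runs_Seq[OF Sum.IH(2)[OF b]], goal_cases)
      case (1 r3)
      have "r3 (d + 3) = ?b j"
        using 1 eq(1) by (metis (no_types, lifting))
      moreover have "r3 v = j" "r3 (d + 1) = r v" "r3 (d + 2) = (\<Sum>i=Suc j..<?n. ?b i)"
          "\<forall>i<d. i \<noteq> v \<longrightarrow> r3 i = r i"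
        using conjunct2[OF 1] that v by auto
      ultimately have *: "r3 (d + 3) = ?b j" "r3 v = j" "r3 (d + 1) = r v"
          "r3 (d + 2) = (\<Sum>i=Suc j..<?n. ?b i)" "\<forall>i<d. i \<noteq> v \<longrightarrow> r3 i = r i"
        by blast+
      show ?case
        by (rule runs_basic) (use * v that in \<open>auto simp: sum.atLeast_Suc_lessThan\<close>)
    qed
  qed
  have "runs (compile (Sum v a b) d) r m
    (eval (cost a) r + ((((\<Sum>j<?n. (?c j + 1 + 1 + 1) + 1) + 1) + (1 + 1)) + 1 + 1 + 1))
    (\<lambda>r'. r' d = eval (Sum v a b) r \<and> (\<forall>i<d. r' i = r i))"
    unfolding compile.simps
  proof (rule runs_Seq[OF Sum.IH(1)], goal_cases)
    case (2 r1)
    show ?case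
    proof (rule runs_Seq_basic, rule runs_Seq_basic, rule runs_Seq_basic, rule runs_Seq)
      show "runs (WhileNZ v ?body) ((r1(d + 1 := r1 v))(v := (r1(d + 1 := r1 v)) d, d + 2 := 0)) m
        ((\<Sum>j<?n. (?c j + 1 + 1 + 1) + 1) + 1) (?I 0)"
        by (rule runs_While[where I = ?I], simp, rule body, assumption, assumption)
          (use 2 v in auto)
    next
      fix r2 assume "?I 0 r2"
      then show "runs (Seq (Move v (d + 1)) (Move d (d + 2))) r2 m (1 + 1)
          (\<lambda>r'. r' d = eval (Sum v a b) r \<and> (\<forall>i<d. r' i = r i))"
        using v by (intro runs_Seq_basic runs_basic) (auto simp: lessThan_atLeast0)
    qed
  qed (use Sum.prems in auto)
  then show ?case by (rule runs_mono) (simp_all add: sum.distrib sum_Suc)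
qed

section \<open>Formulas\<close>

text \<open>Any nonzero value counts as true, so addition is disjunction, a bounded sum is
  existential quantification, and truncated subtraction from 1 is negation.\<close>

definition holds :: "expr \<Rightarrow> (nat \<Rightarrow> nat) \<Rightarrow> bool" where
  "holds e r \<longleftrightarrow> eval e r \<noteq> 0"

definition Neg :: "expr \<Rightarrow> expr" where
  "Neg a = Minus (Num 1) a"

definition Disj :: "expr \<Rightarrow> expr \<Rightarrow> expr" where
  "Disj a b = Plus a b"

definition Conj :: "expr \<Rightarrow> expr \<Rightarrow> expr" where
  "Conj a b = Neg (Disj (Neg a) (Neg b))"

definition Imp :: "expr \<Rightarrow> expr \<Rightarrow> expr" where
  "Imp a b = Disj (Neg a) b"

definition Iff :: "expr \<Rightarrow> expr \<Rightarrow> expr" where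
  "Iff a b = Conj (Imp a b) (Imp b a)"

definition Leq :: "expr \<Rightarrow> expr \<Rightarrow> expr" where
  "Leq a b = Neg (Minus a b)"

definition Equal :: "expr \<Rightarrow> expr \<Rightarrow> expr" where
  "Equal a b = Conj (Leq a b) (Leq b a)"

definition Exists :: "nat \<Rightarrow> expr \<Rightarrow> expr \<Rightarrow> expr" where
  "Exists v a b = Sum v a b"

definition Forall :: "nat \<Rightarrow> expr \<Rightarrow> expr \<Rightarrow> expr" where
  "Forall v a b = Neg (Exists v a (Neg b))"

lemma eval_Neg: "eval (Neg a) r = of_bool (\<not> holds a r)"
  by (auto simp: holds_def Neg_def)

lemma holds_Neg [simp]: "holds (Neg a) r \<longleftrightarrow> \<not> holds a r"
  by (auto simp: holds_def Neg_def)

lemma holds_Disj [simp]: "holds (Disj a b) r \<longleftrightarrow> holds a r \<or> holds b r"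
  by (auto simp: holds_def Disj_def)

text \<open>The outermost operation of \<open>Conj\<close> is \<open>Neg\<close>, so its value is 0
  or 1. Hence a \<open>Sum\<close> over conjunctions counts.\<close>

lemma eval_Conj [simp]: "eval (Conj a b) r = of_bool (holds a r \<and> holds b r)"
  unfolding Conj_def eval_Neg by simp

lemma holds_Conj [simp]: "holds (Conj a b) r \<longleftrightarrow> holds a r \<and> holds b r"
  unfolding Conj_def by simp

lemma holds_Imp [simp]: "holds (Imp a b) r \<longleftrightarrow> (holds a r \<longrightarrow> holds b r)"
  unfolding Imp_def by auto

lemma holds_Iff [simp]: "holds (Iff a b) r \<longleftrightarrow> (holds a r \<longleftrightarrow> holds b r)"
  unfolding Iff_def by auto

lemma holds_Leq [simp]: "holds (Leq a b) r \<longleftrightarrow> eval a r \<le> eval b r"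
  by (simp add: Leq_def) (simp add: holds_def)

lemma holds_Equal [simp]: "holds (Equal a b) r \<longleftrightarrow> eval a r = eval b r"
  unfolding Equal_def by auto

lemma holds_Exists [simp]: "holds (Exists v a b) r \<longleftrightarrow> (\<exists>i<eval a r. holds b (r(v := i)))"
  by (auto simp: holds_def Exists_def)

lemma holds_Forall [simp]: "holds (Forall v a b) r \<longleftrightarrow> (\<forall>i<eval a r. holds b (r(v := i)))"
  unfolding Forall_def by auto

lemma holds_Bit [simp]: "holds (Bit a b) r \<longleftrightarrow> eval a r \<in> set_decode (eval b r)"
  by (simp add: holds_def)

lemma vars_below_connectives [simp]:
  "vars_below d (Neg a) \<longleftrightarrow> vars_below d a"
  "vars_below d (Disj a b) \<longleftrightarrow> vars_below d a \<and> vars_below d b"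
  "vars_below d (Conj a b) \<longleftrightarrow> vars_below d a \<and> vars_below d b"
  "vars_below d (Imp a b) \<longleftrightarrow> vars_below d a \<and> vars_below d b"
  "vars_below d (Iff a b) \<longleftrightarrow> vars_below d a \<and> vars_below d b"
  "vars_below d (Leq a b) \<longleftrightarrow> vars_below d a \<and> vars_below d b"
  "vars_below d (Equal a b) \<longleftrightarrow> vars_below d a \<and> vars_below d b"
  "vars_below d (Exists v a b) \<longleftrightarrow> v < d \<and> vars_below d a \<and> vars_below d b"
  "vars_below d (Forall v a b) \<longleftrightarrow> v < d \<and> vars_below d a \<and> vars_below d b"
  by (auto simp: Neg_def Disj_def Conj_def Imp_def Iff_def Leq_def Equal_def Exists_def Forall_def)

section \<open>Deciding a parameterized problem after kernelization\<close>

text \<open>The parameter, the length of the word and the word itself, read as a binary number with the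
  least significant bit first, are held in the registers 0, 1 and 2.\<close>

definition instance_regs :: "nat \<Rightarrow> nat \<Rightarrow> nat \<Rightarrow> nat \<Rightarrow> nat" where
  "instance_regs k l w = (\<lambda>_. 0)(0 := k, 1 := l, 2 := w)"

lemma sum_of_bool_card: "finite A \<Longrightarrow> (\<Sum>x\<in>A. of_bool (P x)) = card {x\<in>A. P x}"
  by (simp add: sum.If_cases Collect_conj_eq of_bool_def)

section \<open>Words and finite sets as numbers\<close>

text \<open>Trailing \<open>False\<close> letters leave no trace in this number, which is why the
  length occupies a register of its own.\<close>

definition word_number :: "bool list \<Rightarrow> nat" where
  "word_number x = set_encode {i. i < length x \<and> x ! i}"

lemma set_decode_word_number [simp]: "set_decode (word_number x) = {i. i < length x \<and> x ! i}"
  by (simp add: word_number_def)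

text \<open>With \<open>set_decode_subset\<close>, quantifying over subsets of \<open>{..<n}\<close>
  becomes quantifying over numbers below \<open>2 ^ n\<close>.\<close>

lemma set_encode_less: "A \<subseteq> {..<n} \<Longrightarrow> set_encode A < 2 ^ n"
proof -
  assume A: "A \<subseteq> {..<n}"
  have "set_encode A \<le> (\<Sum>i<n. 2 ^ i)"
    unfolding set_encode_def using A by (intro sum_mono2) auto
  also have "\<dots> < 2 ^ n"
    by (induction n) auto
  finally show ?thesis .
qed

lemma set_decode_subset: "s < 2 ^ n \<Longrightarrow> set_decode s \<subseteq> {..<n}"
proof
  fix i assume "s < 2 ^ n" "i \<in> set_decode s"
  show "i \<in> {..<n}"
  proof (rule ccontr)
    assume "i \<notin> {..<n}"
    then have "(2::nat) ^ n \<le> 2 ^ i" by (intro power_increasing) auto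
    then have "s div 2 ^ i = 0" using \<open>s < 2 ^ n\<close> by (intro div_less) linarith
    then show False using \<open>i \<in> set_decode s\<close> by (simp add: set_decode_def)
  qed
qed

lemma word_number_less: "word_number x < 2 ^ length x"
  unfolding word_number_def by (rule set_encode_less) auto

text \<open>Horner's scheme: \<open>w div 2 ^ j\<close> is the number formed by the bits from \<open>j\<close> on.\<close>

definition read_word :: "nat \<Rightarrow> com" where
  "read_word d = Seq (Move d 1) (Seq (Const (d + 1) 1) (WhileNZ d
    (Seq (Sub d d (d + 1)) (Seq (Load (d + 2) d) (Seq (Add 2 2 2) (Add 2 2 (d + 2)))))))"

lemma runs_read_word:
  assumes "3 \<le> d" "r 1 = length x" "r 2 = 0" "\<And>i. i < length x \<Longrightarrow> m i = of_bool (x ! i)"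
  shows "runs (read_word d) r m (length x * 5 + 3)
    (\<lambda>r'. r' 2 = word_number x \<and> (\<forall>i<d. i \<noteq> 2 \<longrightarrow> r' i = r i))"
proof -
  let ?w = "word_number x"
  let ?I = "\<lambda>j r'. j \<le> length x \<and> r' d = j \<and> r' 2 = ?w div 2 ^ j \<and> r' (d + 1) = 1 \<and>
    (\<forall>i<d. i \<noteq> 2 \<longrightarrow> r' i = r i)"
  let ?body = "Seq (Sub d d (d + 1)) (Seq (Load (d + 2) d) (Seq (Add 2 2 2) (Add 2 2 (d + 2))))"
  have "runs (read_word d) r m ((((\<Sum>j<length x. (1 + 1 + 1 + 1) + 1) + 1) + 1) + 1) (?I 0)"
    unfolding read_word_def
  proof (rule runs_Seq_basic, rule runs_Seq_basic, rule runs_While[where I = ?I])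
    \<comment> \<open>Nothing has been read yet, and the quotient is 0 because
      \<open>?w < 2 ^ length x\<close>.\<close>
    show "?I (length x) (r(d := r 1, d + 1 := 1))"
      using assms word_number_less[of x] by auto
    fix j r2 assume "j < length x" and I: "?I (Suc j) r2"
    \<comment> \<open>One Horner step: double and add bit \<open>j\<close>, which is the letter in
      memory cell \<open>j\<close>.\<close>
    have "?w div 2 ^ j = 2 * (?w div 2 ^ Suc j) + of_bool (odd (?w div 2 ^ j))"
      unfolding power_Suc2 div_mult2_eq by simp
    moreover have "odd (?w div 2 ^ j) \<longleftrightarrow> x ! j"
      using set_decode_word_number[of x] \<open>j < length x\<close> by (auto simp: set_decode_def)
    ultimately have "r2 2 + r2 2 + m j = ?w div 2 ^ j"
      using I assms(4)[OF \<open>j < length x\<close>] by simp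
    then show "runs ?body r2 m (1 + 1 + 1 + 1) (?I j)"
      using I assms(1) by (intro runs_Seq_basic runs_basic) auto
  qed simp
  then show ?thesis
    by (rule runs_mono) auto
qed

text \<open>Time bounds are themselves expressions in register 0, so this provides the computable
  function in the definition of tractability.\<close>

lemma computable_eval:
  assumes "vars_below d e" "0 < d"
  shows "computable (\<lambda>k. eval e ((\<lambda>_. 0)(0 := k)))"
  unfolding computable_def
proof (intro exI[of _ "Seq (compile e d) (Move 0 d)"] allI)
  fix k
  have "runs (Seq (compile e d) (Move 0 d)) ((\<lambda>_. 0)(0 := k)) (\<lambda>_. 0)
      (eval (cost e) ((\<lambda>_. 0)(0 := k)) + 1) (\<lambda>r. r 0 = eval e ((\<lambda>_. 0)(0 := k)))"
    by (rule runs_Seq[OF runs_compile[OF assms(1)]]) (auto intro!: runs_basic[unfolded One_nat_def])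
  then show "\<exists>t r m. exec (Seq (compile e d) (Move 0 d)) ((\<lambda>_. 0)(0 := k), \<lambda>_. 0) t (r, m) \<and>
      r 0 = eval e ((\<lambda>_. 0)(0 := k))"
    unfolding runs_def by blast
qed

text \<open>If the length of every yes-instance is bounded in the parameter, then long words are rejected
  right away, and the time bound is the sum of the bounds over all remaining words.\<close>

lemma fixed_parameter_tractableI:
  assumes bound: "\<And>x k. (x, k) \<in> L \<Longrightarrow> length x \<le> eval B ((\<lambda>_. 0)(0 := k))"
    and correct: "\<And>x k. holds e (instance_regs k (length x) (word_number x)) \<longleftrightarrow> (x, k) \<in> L"
    and below: "vars_below d e" "3 \<le> d" and B: "vars_below 1 B"
  shows "fixed_parameter_tractable L"
proof -
  define test where "test = Leq (Var 1) B"
  \<comment> \<open>The conjunction turns an arbitrary truth value into 0 or 1.\<close>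
  define e' where "e' = Conj e e"
  define prog where "prog = Seq (compile test d)
    (IfNZ d (Seq (read_word d) (Seq (compile e' d) (Move 0 d))) (Const 0 0))"
  \<comment> \<open>Register 1 runs over the lengths up to the bound, register 2 over all numbers
    below \<open>2 ^ l\<close>. The five summands \<open>Var 1\<close> pay for the loop of
    \<open>read_word\<close>, and \<open>Num 6\<close> covers the branch and the remaining constant
    number of steps.\<close>
  define F where "F = Plus (cost test) (Plus (Num 6)
    (Sum 1 (Plus B (Num 1)) (Sum 2 (Pow2 (Var 1))
      (Plus (cost e') (Plus (Var 1) (Plus (Var 1) (Plus (Var 1) (Plus (Var 1) (Var 1)))))))))"
  let ?z = "\<lambda>k. (\<lambda>_. 0)(0 := k)"
  let ?f = "\<lambda>k. eval F (?z k)"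
  have B': "vars_below d B" using B below(2) by (auto intro: vars_below_mono)
  have test: "vars_below d test" using B' below(2) by (simp add: test_def)
  have e': "vars_below d e'" using below(1) by (simp add: e'_def)
  have evalB: "eval B r = eval B (?z (r 0))" for r
    using B by (intro eval_cong) auto
  have costB: "eval (cost B) r = eval (cost B) (?z (r 0))" for r
    using vars_below_cost[OF B] by (intro eval_cong) auto
  have "computable ?f"
    using vars_below_cost[OF test] vars_below_cost[OF e'] B' below(2)
    by (intro computable_eval[of d]) (auto simp: F_def)
  \<comment> \<open>Exponent 0 suffices: a long word costs only the test and a constant, and every
    other length is bounded in \<open>k\<close>.\<close>
  moreover have "\<exists>t r m. exec prog (input_state x k) t (r, m) \<and>
      t \<le> ?f k * (length x + 1) ^ 0 \<and> r 0 = (if (x, k) \<in> L then 1 else 0)" for x k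
  proof -
    define m where "m = (\<lambda>i::nat. if i < length x then of_bool (x ! i) else 0 :: nat)"
    define r0 where "r0 = (\<lambda>_::nat. 0::nat)(0 := k, 1 := length x)"
    let ?r = "instance_regs k (length x) (word_number x)"
    let ?Q = "\<lambda>r. r 0 = (if (x, k) \<in> L then 1 else 0::nat)"
    define b where "b = (if length x \<le> eval B (?z k) then length x * 5 + eval (cost e') ?r else 0)"
    have "runs prog r0 m (eval (cost test) r0 + ((b + 5) + 1)) ?Q"
      unfolding prog_def
    proof (rule runs_Seq[OF runs_compile[OF test]])
      fix r1 assume r1: "r1 d = eval test r0 \<and> (\<forall>i<d. r1 i = r0 i)"
      then have d: "r1 d \<noteq> 0 \<longleftrightarrow> length x \<le> eval B (?z k)"
        using evalB[of r0] holds_Leq[of "Var 1" B r0] by (simp add: test_def holds_def r0_def)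
      show "runs (IfNZ d (Seq (read_word d) (Seq (compile e' d) (Move 0 d))) (Const 0 0)) r1 m
        ((b + 5) + 1) ?Q"
      proof (rule runs_If)
        assume "r1 d \<noteq> 0"
        then have b: "b = length x * 5 + eval (cost e') ?r" using d by (simp add: b_def)
        have "runs (Seq (read_word d) (Seq (compile e' d) (Move 0 d))) r1 m
          ((length x * 5 + 3) + (eval (cost e') ?r + 1)) ?Q"
        proof (rule runs_Seq[OF runs_read_word])
          fix r2 assume r2: "r2 2 = word_number x \<and> (\<forall>i<d. i \<noteq> 2 \<longrightarrow> r2 i = r1 i)"
          have r2': "r2 i = ?r i" if "i < d" for i
            using r1 r2 that by (auto simp: instance_regs_def r0_def)
          have eq: "eval e' r2 = eval e' ?r" "eval (cost e') r2 = eval (cost e') ?r"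
            using e' r2' by (auto intro!: eval_cong[of d] vars_below_cost)
          have result: "eval e' r2 = (if (x, k) \<in> L then 1 else 0)"
            unfolding eq(1) by (simp add: e'_def correct)
          show "runs (Seq (compile e' d) (Move 0 d)) r2 m (eval (cost e') ?r + 1) ?Q"
            unfolding eq(2)[symmetric]
            by (rule runs_Seq[OF runs_compile[OF e']])
              (auto intro!: runs_basic[unfolded One_nat_def] simp: result)
        qed (use r1 below(2) in \<open>auto simp: r0_def m_def\<close>)
        then show "runs (Seq (read_word d) (Seq (compile e' d) (Move 0 d))) r1 m (b + 5) ?Q"
          by (rule runs_mono) (simp_all add: b)
      next
        assume "r1 d = 0"
        then have "(x, k) \<notin> L" using d bound by fastforce
        then have "runs (Const 0 0) r1 m 1 ?Q" by (intro runs_basic) auto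
        then show "runs (Const 0 0) r1 m (b + 5) ?Q"
          by (rule runs_mono) auto
      qed
    qed
    moreover have "eval (cost test) r0 + ((b + 5) + 1) \<le> ?f k"
    proof -
      \<comment> \<open>Fetching the length is a single \<open>Move\<close>, so the cost of the test
        depends on \<open>k\<close> only.\<close>
      have test_cost: "eval (cost test) r0 = eval (cost test) (?z k)"
        using costB[of r0] evalB[of r0]
        by (simp add: test_def Leq_def Neg_def r0_def)
      have "b \<le> (\<Sum>l<eval B (?z k) + 1. \<Sum>w<2 ^ l. eval (cost e') (instance_regs k l w) + (l + (l + (l + (l + l)))))"
        (is "_ \<le> (\<Sum>l<_. ?g l)")
      proof (cases "length x \<le> eval B (?z k)")
        case True
        have "b = eval (cost e') ?r +
            (length x + (length x + (length x + (length x + length x))))" using True by (simp add: b_def)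
        \<comment> \<open>The given word supplies one summand of the inner sum, and its length one
          summand of the outer sum.\<close>
        also have "\<dots> \<le> ?g (length x)"
          using word_number_less[of x]
          by (intro member_le_sum[of _ _ "\<lambda>w. eval (cost e') (instance_regs k (length x) w)
            + (length x + (length x + (length x + (length x + length x))))"]) auto
        also have "\<dots> \<le> (\<Sum>l<eval B (?z k) + 1. ?g l)"
          using True by (intro member_le_sum[of _ _ ?g]) auto
        finally show ?thesis .
      qed (simp add: b_def)
      then show ?thesis
        by (simp add: F_def test_cost instance_regs_def)
    qed
    ultimately have "runs prog r0 m (?f k) ?Q" by (rule runs_mono)
    then obtain t r' where "exec prog (r0, m) t (r', m)" "t \<le> ?f k" "?Q r'"
      unfolding runs_def by blast
    moreover have "input_state x k = (r0, m)"
      unfolding input_state_def m_def r0_def ..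
    ultimately show ?thesis
      by (metis mult.right_neutral power_0)
  qed
  ultimately show ?thesis
    unfolding fixed_parameter_tractable_def by blast
qed

section \<open>Global defensive alliances\<close>

lemma neighbours_subset: "simple_graph V E \<Longrightarrow> neighbours E v \<subseteq> V"
  by (auto simp: simple_graph_def neighbours_def)

text \<open>A vertex of the alliance has at most \<open>k + 1\<close> neighbours outside, and the alliance dominates
  everything.\<close>

lemma card_le_of_global_defensive_alliance:
  assumes G: "simple_graph V E" and A: "global_defensive_alliance V E A" and k: "card A \<le> k"
  shows "card V + 1 \<le> (k + 1) ^ 2"
proof -
  have fin: "finite V" and sub: "A \<subseteq> V" and dom: "closed_neighbourhood E A = V"
    using G A by (auto simp: simple_graph_def global_defensive_alliance_def dominating_set_def)
  then have finA: "finite A" by (auto intro: finite_subset)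
  have outside: "card (neighbours E v \<inter> (V - A)) \<le> k + 1" if "v \<in> A" for v
  proof -
    have "card (neighbours E v \<inter> (V - A)) \<le> card (neighbours E v \<inter> A) + 1"
      using A that by (auto simp: global_defensive_alliance_def defensive_alliance_def degree_in_def)
    moreover have "card (neighbours E v \<inter> A) \<le> card A"
      using finA by (intro card_mono) auto
    ultimately show ?thesis using k by simp
  qed
  have "V \<subseteq> A \<union> (\<Union>v\<in>A. neighbours E v \<inter> (V - A))"
    using dom neighbours_subset[OF G] by (auto simp: closed_neighbourhood_def)
  then have "card V \<le> card (A \<union> (\<Union>v\<in>A. neighbours E v \<inter> (V - A)))"
    using fin finA by (intro card_mono) auto
  also have "\<dots> \<le> card A + card (\<Union>v\<in>A. neighbours E v \<inter> (V - A))"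
    by (rule card_Un_le)
  also have "\<dots> \<le> card A + (\<Sum>v\<in>A. card (neighbours E v \<inter> (V - A)))"
    using card_UN_le[OF finA] by (rule add_left_mono)
  also have "\<dots> \<le> card A + card A * (k + 1)"
    using sum_bounded_above[OF outside] by simp
  also have "\<dots> \<le> k + k * (k + 1)"
    using k by (intro add_mono mult_right_mono) auto
  finally show ?thesis by (simp add: power2_eq_square)
qed

section \<open>Reconfiguration as reachability\<close>

text \<open>The symmetric difference is a single vertex. In this form the step is decided by
  counting.\<close>

lemma step_TAR_iff:
  assumes "finite A" "finite B"
  shows "step TAR E A B \<longleftrightarrow> card (A - B) + card (B - A) = 1"
proof
  assume "step TAR E A B"
  then consider v where "v \<notin> A" "B = insert v A" | v where "v \<notin> B" "A = insert v B"
    by auto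
  then show "card (A - B) + card (B - A) = 1"
    by cases (auto simp: insert_Diff_if)
next
  assume "card (A - B) + card (B - A) = 1"
  then consider "card (A - B) = 0" "card (B - A) = 1" | "card (A - B) = 1" "card (B - A) = 0"
    by linarith
  then show "step TAR E A B"
  proof cases
    case 1
    then obtain v where "B - A = {v}" "A \<subseteq> B"
      using assms by (auto simp: card_1_singleton_iff)
    then have "v \<notin> A" "B = insert v A" by auto
    then show ?thesis by auto
  next
    case 2
    then obtain v where "A - B = {v}" "B \<subseteq> A"
      using assms by (auto simp: card_1_singleton_iff)
    then have "v \<notin> B" "A = insert v B" by auto
    then show ?thesis by auto
  qed
qed

definition admissible :: "rule \<Rightarrow> nat \<Rightarrow> 'a set \<Rightarrow> 'a set set \<Rightarrow> 'a set \<Rightarrow> bool" where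
  "admissible Y k V E A \<longleftrightarrow> global_defensive_alliance V E A \<and> (Y = TAR \<longrightarrow> card A \<le> k)"

lemma successively_imp_rtranclp:
  assumes "Ss \<noteq> []" "\<forall>A\<in>set Ss. P A" "successively R Ss"
  shows "(\<lambda>A B. R A B \<and> P B)\<^sup>*\<^sup>* (hd Ss) (last Ss)"
  using assms
proof (induction Ss rule: list_nonempty_induct)
  case (cons A Ss)
  then have "R A (hd Ss) \<and> P (hd Ss)"
    by (cases Ss) auto
  moreover have "(\<lambda>A B. R A B \<and> P B)\<^sup>*\<^sup>* (hd Ss) (last Ss)"
    using cons by (cases Ss) auto
  ultimately show ?case
    using \<open>Ss \<noteq> []\<close> by (auto intro: converse_rtranclp_into_rtranclp)
qed simp

lemma rtranclp_imp_successively: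
  assumes "(\<lambda>A B. R A B \<and> P B)\<^sup>*\<^sup>* S T" "P S"
  shows "\<exists>Ss. Ss \<noteq> [] \<and> hd Ss = S \<and> last Ss = T \<and> (\<forall>A\<in>set Ss. P A) \<and> successively R Ss"
  using assms(1)
proof (induction rule: rtranclp_induct)
  case base
  show ?case using assms(2) by (intro exI[of _ "[S]"]) auto
next
  case (step A B)
  then obtain Ss where "Ss \<noteq> []" "hd Ss = S" "last Ss = A" "\<forall>A\<in>set Ss. P A" "successively R Ss"
    by blast
  with step(2) show ?case
    by (intro exI[of _ "Ss @ [B]"]) (auto simp: successively_append_iff)
qed

text \<open>The relation checks only the target of each step, so admissibility of the start is a
  separate conjunct.\<close>

lemma reconfigurable_iff_rtranclp:
  "reconfigurable Y k V E As At \<longleftrightarrow>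
    admissible Y k V E As \<and> (\<lambda>A B. step Y E A B \<and> admissible Y k V E B)\<^sup>*\<^sup>* As At"
proof
  assume "reconfigurable Y k V E As At"
  then obtain Ss where Ss: "Ss \<noteq> []" "\<forall>A\<in>set Ss. admissible Y k V E A"
      "successively (step Y E) Ss" and ends: "hd Ss = As" "last Ss = At"
    unfolding reconfigurable_def admissible_def by blast
  have "admissible Y k V E As"
    using Ss(1,2) ends(1) hd_in_set by blast
  with successively_imp_rtranclp[OF Ss] show
    "admissible Y k V E As \<and> (\<lambda>A B. step Y E A B \<and> admissible Y k V E B)\<^sup>*\<^sup>* As At"
    unfolding ends by simp
next
  assume "admissible Y k V E As \<and> (\<lambda>A B. step Y E A B \<and> admissible Y k V E B)\<^sup>*\<^sup>* As At"
  then show "reconfigurable Y k V E As At"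
    using rtranclp_imp_successively[of "step Y E" "admissible Y k V E" As At]
    unfolding reconfigurable_def admissible_def by blast
qed

text \<open>Reachability needs no iteration: it is membership in all sets that contain the start and are
  closed under the relation.\<close>

lemma rtranclp_iff_closed_sets:
  assumes "s < N"
  shows "(\<lambda>p q. q < N \<and> R p q)\<^sup>*\<^sup>* s t \<longleftrightarrow>
    (\<forall>w<2 ^ N. s \<in> set_decode w \<and>
      (\<forall>p<N. \<forall>q<N. p \<in> set_decode w \<and> R p q \<longrightarrow> q \<in> set_decode w) \<longrightarrow> t \<in> set_decode w)"
    (is "?R\<^sup>*\<^sup>* s t \<longleftrightarrow> (\<forall>w<2 ^ N. ?closed w \<longrightarrow> _)")
proof (intro iffI allI impI)
  fix w assume "?R\<^sup>*\<^sup>* s t" "w < 2 ^ N" "?closed w"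
  have "t < N \<and> t \<in> set_decode w"
    using \<open>?R\<^sup>*\<^sup>* s t\<close> by (induction rule: rtranclp_induct) (use \<open>?closed w\<close> assms in auto)
  then show "t \<in> set_decode w" ..
next
  assume *: "\<forall>w<2 ^ N. ?closed w \<longrightarrow> t \<in> set_decode w"
  \<comment> \<open>The set of all reachable numbers is itself closed, so it is one of the
    candidates.\<close>
  let ?W = "{q. q < N \<and> ?R\<^sup>*\<^sup>* s q}"
  have decode: "set_decode (set_encode ?W) = ?W"
    by (rule set_encode_inverse) auto
  moreover have "set_encode ?W < 2 ^ N"
    by (rule set_encode_less) auto
  moreover have "?closed (set_encode ?W)"
    unfolding decode using assms by (blast intro: rtranclp.rtrancl_into_rtrancl)
  ultimately have "t \<in> ?W"
    using * by blast
  then show "?R\<^sup>*\<^sup>* s t" by simp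
qed

text \<open>Transfers paths of sets to paths of their codes; \<open>sub\<close> ensures that every
  set entered has a code below \<open>2 ^ n\<close>.\<close>

lemma rtranclp_set_decode_iff:
  assumes "s < 2 ^ n" "t < 2 ^ n" and sub: "\<And>B. P B \<Longrightarrow> B \<subseteq> {..<n}"
  shows "(\<lambda>A B. R A B \<and> P B)\<^sup>*\<^sup>* (set_decode s) (set_decode t) \<longleftrightarrow>
    (\<lambda>p q. q < 2 ^ n \<and> R (set_decode p) (set_decode q) \<and> P (set_decode q))\<^sup>*\<^sup>* s t"
    (is "?R\<^sup>*\<^sup>* _ _ \<longleftrightarrow> ?S\<^sup>*\<^sup>* _ _")
proof
  assume "?R\<^sup>*\<^sup>* (set_decode s) (set_decode t)"
  \<comment> \<open>Finiteness is carried through the induction because \<open>set_decode\<close>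
    inverts \<open>set_encode\<close> only on finite sets.\<close>
  then have "finite (set_decode t) \<and> ?S\<^sup>*\<^sup>* s (set_encode (set_decode t))"
  proof (induction rule: rtranclp_induct)
    case base
    then show ?case by simp
  next
    case (step A B)
    then have "B \<subseteq> {..<n}" using sub by blast
    then have B: "finite B" "set_encode B < 2 ^ n"
      by (auto intro: finite_subset set_encode_less)
    have "?S (set_encode A) (set_encode B)" using step B by simp
    with step.IH have "?S\<^sup>*\<^sup>* s (set_encode B)"
      by (blast intro: rtranclp.rtrancl_into_rtrancl[of ?S])
    with B(1) show ?case ..
  qed
  then show "?S\<^sup>*\<^sup>* s t" by simp
next
  assume "?S\<^sup>*\<^sup>* s t"
  then show "?R\<^sup>*\<^sup>* (set_decode s) (set_decode t)"
  proof (induction rule: rtranclp_induct)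
    case (step p q)
    then have "?R (set_decode p) (set_decode q)" by simp
    with step.IH show ?case
      by (rule rtranclp.rtrancl_into_rtrancl)
  qed simp
qed

section \<open>Words encoding instances\<close>

lemma row_major_less: "u < n \<Longrightarrow> v < n \<Longrightarrow> u * n + v < n * (n::nat)"
proof -
  assume "u < n" "v < n"
  then have "u * n + v < Suc u * n" by simp
  also have "\<dots> \<le> n * n" using \<open>u < n\<close> by (intro mult_right_mono) auto
  finally show ?thesis .
qed

text \<open>The right-nested sums match the nested \<open>Plus\<close> terms by which the formula
  addresses letters.\<close>

lemma length_encode: "length (encode n E As At) = n + (1 + (n * n + (n + n)))"
  by (simp add: encode_def)

lemma nth_encode:
  "i < n \<Longrightarrow> encode n E As At ! i"
  "\<not> encode n E As At ! n"
  "u < n \<Longrightarrow> v < n \<Longrightarrow> encode n E As At ! (n + (1 + (u * n + v))) \<longleftrightarrow> {u, v} \<in> E"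
  "v < n \<Longrightarrow> encode n E As At ! (n + (1 + (n * n + v))) \<longleftrightarrow> v \<in> As"
  "v < n \<Longrightarrow> encode n E As At ! (n + (1 + (n * n + (n + v)))) \<longleftrightarrow> v \<in> At"
  using row_major_less[of u n v] by (auto simp: encode_def nth_append)

text \<open>Reduces being an encoding to conditions on single letters, which bounded quantifiers can
  check.\<close>

lemma eq_encode_iff:
  "x = encode n E As At \<longleftrightarrow>
    length x = n + (1 + (n * n + (n + n))) \<and> (\<forall>i<n. x ! i) \<and> \<not> x ! n \<and>
    (\<forall>u<n. \<forall>v<n. x ! (n + (1 + (u * n + v))) \<longleftrightarrow> {u, v} \<in> E) \<and>
    (\<forall>v<n. (v \<in> As \<longleftrightarrow> x ! (n + (1 + (n * n + v)))) \<and>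
      (v \<in> At \<longleftrightarrow> x ! (n + (1 + (n * n + (n + v))))))" (is "_ \<longleftrightarrow> ?P")
proof
  assume "x = encode n E As At"
  then show ?P by (simp add: length_encode nth_encode[simplified])
next
  assume P: ?P
  show "x = encode n E As At"
  proof (rule nth_equalityI)
    show "length x = length (encode n E As At)" using P by (simp add: length_encode)
    fix i assume "i < length x"
    \<comment> \<open>The blocks of the word: unary number, separator, matrix, and the two
      characteristic vectors.\<close>
    then consider "i < n" | "i = n" | "n < i" "i \<le> n + n * n"
      | "n + n * n < i" "i \<le> n + n * n + n" | "n + n * n + n < i" "i \<le> n + n * n + n + n"
      using P by linarith
    then show "x ! i \<longleftrightarrow> encode n E As At ! i"
    proof cases
      case 3
      define j where "j = i - (n + 1)"
      with 3 have j: "j < n * n" "i = n + (1 + j)" by auto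
      then have "0 < n" by (cases n) auto
      then have "j div n < n" "j mod n < n" "j = (j div n) * n + j mod n"
        using j(1) by (auto simp: less_mult_imp_div_less)
      then show ?thesis using P j(2) nth_encode(3) by metis
    next
      case 4
      define v where "v = i - (n + n * n + 1)"
      with 4 have "v < n" "i = n + (1 + (n * n + v))" by auto
      then show ?thesis using P nth_encode(4) by metis
    next
      case 5
      define v where "v = i - (n + n * n + n + 1)"
      with 5 have "v < n" "i = n + (1 + (n * n + (n + v)))" by auto
      then show ?thesis using P nth_encode(5) by metis
    qed (use P nth_encode(1,2) in auto)
  qed
qed

section \<open>The formula for reconfigurability\<close>

text \<open>Registers 0 to 2 hold the parameter, the length of the word and the word; register 3 holds the
  number of vertices, 4 and 5 the two given alliances, 6 a family of vertex sets, 7 and 8 members of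
  it, and 9 to 11 are bound inside the subformulas. Vertex sets are numbers below \<open>2 ^ n\<close>, families of vertex sets numbers below \<open>2 ^ 2 ^ n\<close>.\<close>

definition adjacent_expr :: "nat \<Rightarrow> nat \<Rightarrow> expr" where
  "adjacent_expr u v =
    Bit (Plus (Var 3) (Plus (Num 1) (Plus (Sum 11 (Var u) (Var 3)) (Var v)))) (Var 2)"

text \<open>The edge set is not quantified: it is read off the matrix, which only has to be
  symmetric with empty diagonal.\<close>

definition encoded_expr :: expr where
  "encoded_expr =
    Conj (Equal (Var 1)
      (Plus (Var 3) (Plus (Num 1) (Plus (Sum 9 (Var 3) (Var 3)) (Plus (Var 3) (Var 3))))))
    (Conj (Forall 9 (Var 3) (Bit (Var 9) (Var 2)))
    (Conj (Neg (Bit (Var 3) (Var 2)))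
    (Conj (Forall 9 (Var 3) (Forall 10 (Var 3) (Imp (adjacent_expr 9 10)
      (Conj (adjacent_expr 10 9) (Neg (Equal (Var 9) (Var 10)))))))
    (Forall 9 (Var 3) (Conj
      (Iff (Bit (Var 9) (Var 4))
        (Bit (Plus (Var 3) (Plus (Num 1) (Plus (Sum 11 (Var 3) (Var 3)) (Var 9)))) (Var 2)))
      (Iff (Bit (Var 9) (Var 5))
        (Bit (Plus (Var 3) (Plus (Num 1) (Plus (Sum 11 (Var 3) (Var 3)) (Plus (Var 3) (Var 9)))))
          (Var 2))))))))"

text \<open>The vertex whose neighbours are counted is expected in register 9.\<close>

definition degree_expr :: "nat \<Rightarrow> expr" where
  "degree_expr S = Sum 10 (Var 3) (Conj (adjacent_expr 9 10) (Bit (Var 10) (Var S)))"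

definition codegree_expr :: "nat \<Rightarrow> expr" where
  "codegree_expr S = Sum 10 (Var 3) (Conj (adjacent_expr 9 10) (Neg (Bit (Var 10) (Var S))))"

definition alliance_expr :: "nat \<Rightarrow> expr" where
  "alliance_expr S = Conj
    (Forall 9 (Var 3) (Imp (Bit (Var 9) (Var S))
      (Leq (codegree_expr S) (Plus (degree_expr S) (Num 1)))))
    (Forall 9 (Var 3) (Disj (Bit (Var 9) (Var S))
      (Exists 10 (Var 3) (Conj (Bit (Var 10) (Var S)) (adjacent_expr 10 9)))))"

definition card_expr :: "nat \<Rightarrow> expr" where
  "card_expr S = Sum 9 (Var 3) (Bit (Var 9) (Var S))"

definition card_diff_expr :: "nat \<Rightarrow> nat \<Rightarrow> expr" where
  "card_diff_expr S T = Sum 9 (Var 3) (Conj (Bit (Var 9) (Var S)) (Neg (Bit (Var 9) (Var T))))"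

definition swap_expr :: "nat \<Rightarrow> nat \<Rightarrow> expr" where
  "swap_expr S T =
    Conj (Equal (card_expr S) (card_expr T)) (Equal (card_diff_expr S T) (Num 1))"

primrec step_expr :: "rule \<Rightarrow> nat \<Rightarrow> nat \<Rightarrow> expr" where
  "step_expr TJ S T = swap_expr S T"
| "step_expr TS S T = Conj (swap_expr S T)
    (Exists 9 (Var 3) (Exists 10 (Var 3) (Conj
      (Conj (Bit (Var 9) (Var S)) (Neg (Bit (Var 9) (Var T))))
      (Conj (Conj (Bit (Var 10) (Var T)) (Neg (Bit (Var 10) (Var S)))) (adjacent_expr 9 10)))))"
| "step_expr TAR S T = Equal (Plus (card_diff_expr S T) (card_diff_expr T S)) (Num 1)"

definition admissible_expr :: "rule \<Rightarrow> nat \<Rightarrow> expr" where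
  "admissible_expr Y S =
    Conj (alliance_expr S) (if Y = TAR then Leq (card_expr S) (Var 0) else Num 1)"

text \<open>The right-hand side of \<open>rtranclp_iff_closed_sets\<close> with
  \<open>N = 2 ^ n\<close>.\<close>

definition reachable_expr :: "rule \<Rightarrow> expr" where
  "reachable_expr Y =
    Forall 6 (Pow2 (Pow2 (Var 3))) (Imp
      (Conj (Bit (Var 4) (Var 6))
        (Forall 7 (Pow2 (Var 3)) (Forall 8 (Pow2 (Var 3)) (Imp
          (Conj (Bit (Var 7) (Var 6)) (Conj (step_expr Y 7 8) (admissible_expr Y 8)))
          (Bit (Var 8) (Var 6))))))
      (Bit (Var 5) (Var 6)))"

definition sizes_expr :: "rule \<Rightarrow> expr" where
  "sizes_expr Y = (if Y = TAR then Num 1 else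
    Conj (Equal (card_expr 4) (Var 0)) (Equal (card_expr 5) (Var 0)))"

text \<open>The three quantifiers guess the decoding of the word; an encoding of a graph on
  \<open>n\<close> vertices is longer than \<open>n\<close>.\<close>

definition reconf_expr :: "rule \<Rightarrow> expr" where
  "reconf_expr Y =
    Exists 3 (Var 1) (Exists 4 (Pow2 (Var 3)) (Exists 5 (Pow2 (Var 3))
      (Conj encoded_expr (Conj (alliance_expr 4) (Conj (alliance_expr 5)
        (Conj (sizes_expr Y) (Conj (admissible_expr Y 4) (reachable_expr Y))))))))"

lemma vars_below_reconf_expr: "vars_below 12 (reconf_expr Y)"
  by (cases Y) (simp_all add: reconf_expr_def encoded_expr_def alliance_expr_def sizes_expr_def
    admissible_expr_def reachable_expr_def swap_expr_def card_expr_def card_diff_expr_def degree_expr_def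
    codegree_expr_def adjacent_expr_def)

section \<open>Correctness of the formula\<close>

text \<open>Ties an abstract graph to the matrix bits of the word. Only registers 2 and 3 are
  involved, so writing to bound variables above 3 preserves it.\<close>

definition graph_regs :: "(nat \<Rightarrow> nat) \<Rightarrow> nat \<Rightarrow> nat set set \<Rightarrow> bool" where
  "graph_regs r n E \<longleftrightarrow> r 3 = n \<and> simple_graph {..<n} E \<and>
    (\<forall>u<n. \<forall>v<n. n + (1 + (u * n + v)) \<in> set_decode (r 2) \<longleftrightarrow> {u, v} \<in> E)"

lemma graph_regs_upd: "3 < i \<Longrightarrow> graph_regs r n E \<Longrightarrow> graph_regs (r(i := x)) n E"
  by (simp add: graph_regs_def)

lemma holds_Num [simp]: "holds (Num n) r \<longleftrightarrow> n \<noteq> 0"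
  by (simp add: holds_def)

text \<open>Here \<open>u\<close> and \<open>v\<close> are registers; the vertices are their
  contents.\<close>

lemma holds_adjacent_expr:
  assumes "graph_regs r n E" "r u < n" "r v < n"
  shows "holds (adjacent_expr u v) r \<longleftrightarrow> {r u, r v} \<in> E"
  using assms by (simp add: adjacent_expr_def graph_regs_def)

lemma eval_count:
  assumes "\<And>i. i < eval a r \<Longrightarrow> holds (Conj b c) (r(v := i)) \<longleftrightarrow> i \<in> A" "A \<subseteq> {..<eval a r}"
  shows "eval (Sum v a (Conj b c)) r = card A"
proof -
  have "eval (Sum v a (Conj b c)) r = (\<Sum>i<eval a r. of_bool (i \<in> A))"
    using assms(1) by (auto intro!: sum.cong)
  also have "\<dots> = card {i\<in>{..<eval a r}. i \<in> A}"
    by (rule sum_of_bool_card) simp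
  also have "{i\<in>{..<eval a r}. i \<in> A} = A"
    using assms(2) by auto
  finally show ?thesis .
qed

lemma eval_degree_expr:
  assumes "graph_regs r n E" "r 9 < n" "S \<noteq> 10" "r S < 2 ^ n"
  shows "eval (degree_expr S) r = degree_in E (set_decode (r S)) (r 9)"
    and "eval (codegree_expr S) r = degree_in E ({..<n} - set_decode (r S)) (r 9)"
proof -
  have n: "r 3 = n" "simple_graph {..<n} E" using assms(1) by (auto simp: graph_regs_def)
  have adj: "holds (adjacent_expr 9 10) (r(10 := i)) \<longleftrightarrow> {r 9, i} \<in> E" if "i < n" for i
    using holds_adjacent_expr[of "r(10 := i)" n E 9 10] assms(1,2) that by (simp add: graph_regs_upd)
  show "eval (degree_expr S) r = degree_in E (set_decode (r S)) (r 9)"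
    unfolding degree_expr_def degree_in_def
    by (rule eval_count) (use assms(3) n adj set_decode_subset[OF assms(4)] in
      \<open>auto simp: neighbours_def\<close>)
  show "eval (codegree_expr S) r = degree_in E ({..<n} - set_decode (r S)) (r 9)"
    unfolding codegree_expr_def degree_in_def
    by (rule eval_count) (use assms(3) n adj in \<open>auto simp: neighbours_def\<close>)
qed

lemma holds_alliance_expr:
  assumes r: "graph_regs r n E" and S: "S \<noteq> 9" "S \<noteq> 10" "r S < 2 ^ n"
  shows "holds (alliance_expr S) r \<longleftrightarrow> global_defensive_alliance {..<n} E (set_decode (r S))"
proof -
  let ?A = "set_decode (r S)"
  have n: "r 3 = n" "simple_graph {..<n} E" using r by (auto simp: graph_regs_def)
  have A: "?A \<subseteq> {..<n}" using S(3) by (rule set_decode_subset)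
  have deg: "eval (degree_expr S) (r(9 := v)) = degree_in E ?A v"
      "eval (codegree_expr S) (r(9 := v)) = degree_in E ({..<n} - ?A) v" if "v < n" for v
    using eval_degree_expr[of "r(9 := v)" n E S] r S that by (simp_all add: graph_regs_upd)
  have adj: "holds (adjacent_expr 10 9) (r(9 := v, 10 := u)) \<longleftrightarrow> {u, v} \<in> E"
    if "u < n" "v < n" for u v
    using holds_adjacent_expr[of "r(9 := v, 10 := u)" n E 10 9] r that by (simp add: graph_regs_upd)
  have "holds (alliance_expr S) r \<longleftrightarrow>
      (\<forall>v<n. v \<in> ?A \<longrightarrow> degree_in E ({..<n} - ?A) v \<le> degree_in E ?A v + 1) \<and>
      (\<forall>v<n. v \<in> ?A \<or> (\<exists>u<n. u \<in> ?A \<and> {u, v} \<in> E))"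
    \<comment> \<open>\<open>conj_cong\<close> makes \<open>u < n\<close> available below the
      existential quantifier, as \<open>adj\<close> requires.\<close>
    using S n by (simp add: alliance_expr_def deg adj cong: conj_cong)
  also have "(\<forall>v<n. v \<in> ?A \<longrightarrow> degree_in E ({..<n} - ?A) v \<le> degree_in E ?A v + 1) \<longleftrightarrow>
      defensive_alliance {..<n} E ?A"
    using A by (auto simp: defensive_alliance_def)
  also have "(\<forall>v<n. v \<in> ?A \<or> (\<exists>u<n. u \<in> ?A \<and> {u, v} \<in> E)) \<longleftrightarrow> dominating_set {..<n} E ?A"
  proof -
    \<comment> \<open>A closed neighbourhood never leaves the vertex set, so only the other
      inclusion is left to test.\<close>
    have "closed_neighbourhood E ?A \<subseteq> {..<n}"
      using A neighbours_subset[OF n(2)] by (auto simp: closed_neighbourhood_def)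
    then have "dominating_set {..<n} E ?A \<longleftrightarrow> (\<forall>v<n. v \<in> closed_neighbourhood E ?A)"
      using A by (auto simp: dominating_set_def)
    moreover have "v \<in> closed_neighbourhood E ?A \<longleftrightarrow>
        v \<in> ?A \<or> (\<exists>u<n. u \<in> ?A \<and> {u, v} \<in> E)" for v
      using A by (auto simp: closed_neighbourhood_def neighbours_def)
    ultimately show ?thesis by simp
  qed
  finally show ?thesis unfolding global_defensive_alliance_def .
qed

lemma eval_card_expr:
  assumes "r S < 2 ^ r 3" "S \<noteq> 9"
  shows "eval (card_expr S) r = card (set_decode (r S))"
proof -
  have "eval (card_expr S) r = card {i\<in>{..<r 3}. i \<in> set_decode (r S)}"
    using assms(2) sum_of_bool_card[of "{..<r 3}" "\<lambda>i. i \<in> set_decode (r S)"]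
    by (simp add: card_expr_def)
  also have "{i\<in>{..<r 3}. i \<in> set_decode (r S)} = set_decode (r S)"
    using set_decode_subset[OF assms(1)] by auto
  finally show ?thesis .
qed

lemma eval_card_diff_expr:
  assumes "r S < 2 ^ r 3" "S \<noteq> 9" "T \<noteq> 9"
  shows "eval (card_diff_expr S T) r = card (set_decode (r S) - set_decode (r T))"
  unfolding card_diff_expr_def using assms set_decode_subset[OF assms(1)]
  by (intro eval_count) auto

lemma holds_step_expr:
  assumes r: "graph_regs r n E" and S: "S \<notin> {9, 10}" "r S < 2 ^ n" and T: "T \<notin> {9, 10}" "r T < 2 ^ n"
  shows "holds (step_expr Y S T) r \<longleftrightarrow> step Y E (set_decode (r S)) (set_decode (r T))"
proof -
  have n: "r 3 = n" "simple_graph {..<n} E" using r by (auto simp: graph_regs_def)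
  have sub: "set_decode (r S) \<subseteq> {..<n}" "set_decode (r T) \<subseteq> {..<n}"
    using S T set_decode_subset by auto
  have adj: "holds (adjacent_expr 9 10) (r(9 := u, 10 := v)) \<longleftrightarrow> {u, v} \<in> E"
    if "u < n" "v < n" for u v
    using holds_adjacent_expr[of "r(9 := u, 10 := v)" n E 9 10] r that by (simp add: graph_regs_upd)
  have TJ: "holds (step_expr TJ S T) r \<longleftrightarrow> step TJ E (set_decode (r S)) (set_decode (r T))"
    using S T n by (simp add: swap_expr_def eval_card_expr eval_card_diff_expr)
  show ?thesis
  proof (cases Y)
    case TS
    have "holds (step_expr TS S T) r \<longleftrightarrow> holds (swap_expr S T) r \<and>
        (\<exists>u<n. \<exists>v<n. (u \<in> set_decode (r S) \<and> u \<notin> set_decode (r T)) \<and>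
          (v \<in> set_decode (r T) \<and> v \<notin> set_decode (r S)) \<and> {u, v} \<in> E)"
      using S T n by (simp add: adj cong: conj_cong)
    then show ?thesis
      unfolding TS using TJ sub by auto
  next
    case TAR
    show ?thesis
      unfolding TAR using S T n
      by (subst step_TAR_iff) (auto simp: eval_card_diff_expr)
  qed (use TJ in simp)
qed

lemma holds_admissible_expr:
  assumes "graph_regs r n E" "S \<notin> {9, 10}" "r S < 2 ^ n"
  shows "holds (admissible_expr Y S) r \<longleftrightarrow> admissible Y (r 0) {..<n} E (set_decode (r S))"
proof -
  have "r 3 = n" using assms(1) by (simp add: graph_regs_def)
  then show ?thesis
    using assms holds_alliance_expr[of r n E S]
    by (auto simp: admissible_expr_def admissible_def eval_card_expr)
qed

lemma admissible_subset: "admissible Y k V E A \<Longrightarrow> A \<subseteq> V"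
  by (simp add: admissible_def global_defensive_alliance_def defensive_alliance_def)

lemma holds_reachable_expr:
  assumes r: "graph_regs r n E" and s: "r 4 < 2 ^ n" and t: "r 5 < 2 ^ n"
  shows "holds (reachable_expr Y) r \<longleftrightarrow>
    (\<lambda>A B. step Y E A B \<and> admissible Y (r 0) {..<n} E B)\<^sup>*\<^sup>* (set_decode (r 4)) (set_decode (r 5))"
proof -
  have n: "r 3 = n" using r by (auto simp: graph_regs_def)
  let ?r = "\<lambda>w p q. r(6 := w, 7 := p, 8 := q)"
  have step: "holds (step_expr Y 7 8) (?r w p q) \<longleftrightarrow> step Y E (set_decode p) (set_decode q)"
    if "p < 2 ^ n" "q < 2 ^ n" for w p q
    using holds_step_expr[of "?r w p q" n E 7 8 Y] r that by (simp add: graph_regs_upd)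
  have adm: "holds (admissible_expr Y 8) (?r w p q) \<longleftrightarrow> admissible Y (r 0) {..<n} E (set_decode q)"
    if "q < 2 ^ n" for w p q
    using holds_admissible_expr[of "?r w p q" n E 8 Y] r that by (simp add: graph_regs_upd)
  \<comment> \<open>Reachability passes from sets to codes, and then to membership in all closed
    families of codes.\<close>
  show ?thesis
    using n
    by (simp add: rtranclp_set_decode_iff[OF s t, where R = "step Y E" and
        P = "admissible Y (r 0) {..<n} E", OF admissible_subset]
      rtranclp_iff_closed_sets[OF s] reachable_expr_def step adm)
qed

lemma holds_sizes_expr:
  assumes "r 4 < 2 ^ r 3" "r 5 < 2 ^ r 3"
  shows "holds (sizes_expr Y) r \<longleftrightarrow>
    (Y \<noteq> TAR \<longrightarrow> card (set_decode (r 4)) = r 0 \<and> card (set_decode (r 5)) = r 0)"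
  using assms by (simp add: sizes_expr_def eval_card_expr)

lemma holds_encoded_expr:
  assumes r: "r 1 = length x" "r 2 = word_number x" "r 3 = n"
  shows "holds encoded_expr r \<longleftrightarrow>
    (\<exists>E. graph_regs r n E \<and> x = encode n E (set_decode (r 4)) (set_decode (r 5)))"
proof -
  let ?adj = "\<lambda>u v. x ! (n + (1 + (u * n + v)))"
  have less: "n + (1 + (u * n + v)) < n + (1 + (n * n + (n + n)))" if "u < n" "v < n" for u v
    using row_major_less[OF that] by simp
  have adj: "holds (adjacent_expr 9 10) (r(9 := u, 10 := v)) \<longleftrightarrow> ?adj u v"
      "holds (adjacent_expr 10 9) (r(9 := u, 10 := v)) \<longleftrightarrow> ?adj v u"
    if "u < n" "v < n" "length x = n + (1 + (n * n + (n + n)))" for u v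
    using that less[OF that(1,2)] less[OF that(2,1)] by (simp_all add: adjacent_expr_def r)
  have holds_iff: "holds encoded_expr r \<longleftrightarrow> length x = n + (1 + (n * n + (n + n))) \<and>
      (\<forall>i<n. x ! i) \<and> \<not> x ! n \<and> (\<forall>u<n. \<forall>v<n. ?adj u v \<longrightarrow> ?adj v u \<and> u \<noteq> v) \<and>
      (\<forall>v<n. (v \<in> set_decode (r 4) \<longleftrightarrow> x ! (n + (1 + (n * n + v)))) \<and>
        (v \<in> set_decode (r 5) \<longleftrightarrow> x ! (n + (1 + (n * n + (n + v))))))"
  \<comment> \<open>Beyond the end of the word the number has zero bits while \<open>x ! i\<close>
    is unspecified; the right length keeps all positions in range.\<close>
  proof (cases "length x = n + (1 + (n * n + (n + n)))")
    case True
    have word: "i \<in> set_decode (word_number x) \<longleftrightarrow> x ! i"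
      if "i < n + (1 + (n * n + (n + n)))" for i
      using that True by simp
    show ?thesis
      by (simp add: encoded_expr_def r r(1)[unfolded One_nat_def] True adj[OF _ _ True] word
        del: set_decode_word_number set_decode_Suc)
  qed (simp add: encoded_expr_def r r(1)[unfolded One_nat_def])
  show ?thesis
  proof
    assume *: "holds encoded_expr r"
    \<comment> \<open>Since the matrix is symmetric, turning its entries into unordered pairs loses
      nothing.\<close>
    define E where "E = {{u, v} | u v. u < n \<and> v < n \<and> ?adj u v}"
    have E: "{u, v} \<in> E \<longleftrightarrow> ?adj u v" if "u < n" "v < n" for u v
      using that * unfolding holds_iff by (auto simp: E_def doubleton_eq_iff)
    have "u \<noteq> v" if "u < n" "v < n" "?adj u v" for u v
      using that * unfolding holds_iff by blast
    then have "simple_graph {..<n} E"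
      by (auto simp: simple_graph_def E_def card_insert_if)
    then have "graph_regs r n E"
      using * E less unfolding holds_iff by (auto simp: graph_regs_def r)
    moreover have "x = encode n E (set_decode (r 4)) (set_decode (r 5))"
      using * E unfolding holds_iff eq_encode_iff by auto
    ultimately show "\<exists>E. graph_regs r n E \<and> x = encode n E (set_decode (r 4)) (set_decode (r 5))"
      by blast
  next
    assume "\<exists>E. graph_regs r n E \<and> x = encode n E (set_decode (r 4)) (set_decode (r 5))"
    then obtain E where E: "simple_graph {..<n} E"
        "x = encode n E (set_decode (r 4)) (set_decode (r 5))"
      by (auto simp: graph_regs_def)
    have "{u, v} \<in> E \<Longrightarrow> u \<noteq> v" for u v
      using E(1) by (auto simp: simple_graph_def)
    then show "holds encoded_expr r"
      using E(2) unfolding holds_iff eq_encode_iff by (simp add: insert_commute)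
  qed
qed

lemma graph_regs_instance:
  assumes "simple_graph {..<n} E" "r 3 = n" "r 2 = word_number (encode n E As At)"
  shows "graph_regs r n E"
  unfolding graph_regs_def
proof (intro conjI allI impI)
  fix u v assume uv: "u < n" "v < n"
  have "n + (1 + (u * n + v)) < length (encode n E As At)"
    using row_major_less[OF uv] by (simp add: length_encode)
  then show "n + (1 + (u * n + v)) \<in> set_decode (r 2) \<longleftrightarrow> {u, v} \<in> E"
    using nth_encode(3)[OF uv] assms(3) by simp
qed (use assms in auto)

lemma holds_reconf_expr:
  "holds (reconf_expr Y) (instance_regs k (length x) (word_number x)) \<longleftrightarrow> (x, k) \<in> GDA_Reconf Y"
proof -
  let ?r = "\<lambda>n s t. (instance_regs k (length x) (word_number x))(3 := n, 4 := s, 5 := t)"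
  let ?inst = "\<lambda>n E As At. simple_graph {..<n} E \<and> global_defensive_alliance {..<n} E As \<and>
    global_defensive_alliance {..<n} E At \<and> (Y \<noteq> TAR \<longrightarrow> card As = k \<and> card At = k) \<and>
    reconfigurable Y k {..<n} E As At"
  let ?body = "Conj (alliance_expr 4) (Conj (alliance_expr 5)
    (Conj (sizes_expr Y) (Conj (admissible_expr Y 4) (reachable_expr Y))))"
  \<comment> \<open>Stated for every \<open>E\<close> that fits the registers, hence for the one
    that \<open>encoded\<close> extracts from the word.\<close>
  have body: "holds ?body (?r n s t) \<longleftrightarrow> ?inst n E (set_decode s) (set_decode t)"
    if "graph_regs (?r n s t) n E" "s < 2 ^ n" "t < 2 ^ n" for n s t E
    using that holds_alliance_expr[OF that(1), of 4] holds_alliance_expr[OF that(1), of 5]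
      holds_sizes_expr[of "?r n s t" Y] holds_admissible_expr[OF that(1), of 4 Y]
      holds_reachable_expr[OF that(1), of Y]
    by (simp add: reconfigurable_iff_rtranclp instance_regs_def) (auto simp: graph_regs_def)
  have encoded: "holds encoded_expr (?r n s t) \<longleftrightarrow>
      (\<exists>E. graph_regs (?r n s t) n E \<and> x = encode n E (set_decode s) (set_decode t))" for n s t
    using holds_encoded_expr[of "?r n s t" x n] by (simp add: instance_regs_def)
  have "holds (reconf_expr Y) (instance_regs k (length x) (word_number x)) \<longleftrightarrow>
      (\<exists>n<length x. \<exists>s<2 ^ n. \<exists>t<2 ^ n. holds encoded_expr (?r n s t) \<and> holds ?body (?r n s t))"
    by (simp add: reconf_expr_def instance_regs_def)
  also have "\<dots> \<longleftrightarrow> (\<exists>n E As At. x = encode n E As At \<and> ?inst n E As At)"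
  proof
    assume "\<exists>n<length x. \<exists>s<2 ^ n. \<exists>t<2 ^ n. holds encoded_expr (?r n s t) \<and> holds ?body (?r n s t)"
    then show "\<exists>n E As At. x = encode n E As At \<and> ?inst n E As At"
      using encoded body by metis
  next
    assume "\<exists>n E As At. x = encode n E As At \<and> ?inst n E As At"
    then obtain n E As At where x: "x = encode n E As At" and inst: "?inst n E As At"
      by blast
    then have sub: "As \<subseteq> {..<n}" "At \<subseteq> {..<n}"
      by (auto simp: global_defensive_alliance_def defensive_alliance_def)
    then have fin: "finite As" "finite At"
      by (auto intro: finite_subset)
    let ?s = "set_encode As" and ?t = "set_encode At"
    have st: "?s < 2 ^ n" "?t < 2 ^ n"
      using sub by (auto intro: set_encode_less)
    have E: "graph_regs (?r n ?s ?t) n E"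
      using inst x by (intro graph_regs_instance[of n E _ As At]) (auto simp: instance_regs_def)
    have "holds encoded_expr (?r n ?s ?t)"
      unfolding encoded using E x fin by auto
    moreover have "holds ?body (?r n ?s ?t)"
      unfolding body[OF E st] using inst fin by simp
    moreover have "n < length x"
      using x by (simp add: length_encode)
    ultimately show "\<exists>n<length x. \<exists>s<2 ^ n. \<exists>t<2 ^ n.
        holds encoded_expr (?r n s t) \<and> holds ?body (?r n s t)"
      using st by blast
  qed
  also have "\<dots> \<longleftrightarrow> (x, k) \<in> GDA_Reconf Y"
    unfolding GDA_Reconf_def by auto
  finally show ?thesis .
qed

section \<open>Length of yes-instances and conclusion\<close>

text \<open>The length is at most \<open>2 * (n + 1) ^ 2\<close>, and
  \<open>n + 1 \<le> (k + 1) ^ 2\<close>. Estimating \<open>k + 1\<close> by \<open>2 ^ k\<close>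
  gives a bound that a single \<open>Pow2\<close> expresses.\<close>

lemma GDA_Reconf_length_bound:
  assumes "(x, k) \<in> GDA_Reconf Y"
  shows "length x \<le> 2 ^ (4 * k + 1)"
proof -
  obtain n E As At where x: "x = encode n E As At" and G: "simple_graph {..<n} E"
    and As: "global_defensive_alliance {..<n} E As"
    and size: "Y \<noteq> TAR \<longrightarrow> card As = k" and reconf: "reconfigurable Y k {..<n} E As At"
    using assms unfolding GDA_Reconf_def by auto
  \<comment> \<open>For \<open>TAR\<close> the bound comes from the sequence, whose first set is
    \<open>As\<close>; otherwise \<open>k\<close> is the size of \<open>As\<close>.\<close>
  have "card As \<le> k"
    using size reconf by (cases "Y = TAR") (auto simp: reconfigurable_iff_rtranclp admissible_def)
  then have "n + 1 \<le> (k + 1) ^ 2"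
    using card_le_of_global_defensive_alliance[OF G As] by simp
  moreover have "k + 1 \<le> 2 ^ k"
    by (simp add: Suc_leI)
  ultimately have "n + 1 \<le> (2 ^ k) ^ 2"
    by (meson le_trans power_mono zero_le)
  then have "(n + 1) ^ 2 \<le> ((2 ^ k) ^ 2) ^ 2"
    by (rule power_mono) simp
  then have "(n + 1) ^ 2 \<le> 2 ^ (4 * k)"
    by (simp flip: power_mult add: mult.commute)
  moreover have "length x \<le> 2 * (n + 1) ^ 2"
    unfolding x length_encode by (simp add: power2_eq_square)
  ultimately show ?thesis by simp
qed

theorem theorem9:
  fixes Y :: rule
  shows "fixed_parameter_tractable (GDA_Reconf Y)"
proof (rule fixed_parameter_tractableI[OF _ holds_reconf_expr vars_below_reconf_expr])
  let ?B = "Pow2 (Plus (Plus (Plus (Var 0) (Var 0)) (Plus (Var 0) (Var 0))) (Num 1))"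
  show "length x \<le> eval ?B ((\<lambda>_. 0)(0 := k))" if "(x, k) \<in> GDA_Reconf Y" for x k
  proof -
    have "4 * k = k + k + (k + k)" by simp
    then show ?thesis
      using GDA_Reconf_length_bound[OF that] by (simp only: eval.simps fun_upd_same)
  qed
  show "vars_below 1 ?B" by simp
qed simp

end
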